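(* Let $V$ be a VOA of central charge $c$ with an involutive automorphism $t$, $V=V^+\oplus V^-$ its decomposition into $\pm1$-eigenspaces, $u,v\in V^-$ and $n\ge1$. Then \[ Z_{V^+}(u[-n]v,\tau)=\tfrac12\delta_{n,1}\mathrm{Tr}_V\,o(u)o(v)q^{L(0)-c/24}+\sum_{m\ge0}\frac1m\widehat F_{n+m}(\tau)Z_{V^+}(u[m]v,\tau)+\frac12\sum_{m\ge1}\frac1m\big(\widehat E_{n+m}(\tau)-\widehat F_{n+m}(\tau)\big)Z_V(u[m]v,\tau), \] where $\frac1m\widehat F_{n+m}(\tau)$ means $(-1)^{m+1}\binom{n+m-1}{m}F_{n+m}(\tau)$ (so the $m=0$ term equals $-F_n(\tau)Z_{V^+}(u[0]v,\tau)$).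
   Context: $q=e^{2\pi i\tau}$. Square bracket modes: $Y[v,z]=\sum_nv[n]z^{-n-1}:=Y_V(e^{zL(0)}v,e^z-1)$. Zero mode $o(v)=v(w-1)$ for $v$ of weight $w$, extended linearly. $Z_W(x,\tau)=\mathrm{Tr}_Wo(x)q^{L(0)-c/24}$ for $W=V,V^+$. $E_k(\tau)=-\frac{B_k}{k!}+\frac{2}{(k-1)!}\sum_{n\ge1}\sigma_{k-1}(n)q^n$ for even $k$, $E_k=0$ for odd $k$; $F_k(\tau)=2E_k(2\tau)-E_k(\tau)$. For positive integers $a,b$: $\widehat E_{a+b}=(-1)^{b+1}b\binom{a+b-1}{b}E_{a+b}$, $\widehat F_{a+b}=(-1)^{b+1}b\binom{a+b-1}{b}F_{a+b}$ (here $a=n$, $b=m$). *)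

theory Defs
  imports Complex_Main "HOL-Computational_Algebra.Formal_Power_Series"
    "HOL-Computational_Algebra.Formal_Laurent_Series"
begin

class cvector = ab_group_add +
  fixes csc :: "complex \<Rightarrow> 'a \<Rightarrow> 'a"  (infixr \<open>*\<^sub>c\<close> 75)
  assumes csc_add_right: "a *\<^sub>c (x + y) = a *\<^sub>c x + a *\<^sub>c y"
    and csc_add_left: "(a + b) *\<^sub>c x = a *\<^sub>c x + b *\<^sub>c x"
    and csc_csc: "a *\<^sub>c (b *\<^sub>c x) = (a * b) *\<^sub>c x"
    and csc_one: "1 *\<^sub>c x = x"

lemma vector_space_csc: "vector_space (csc :: complex \<Rightarrow> 'a::cvector \<Rightarrow> 'a)"
  by unfold_locales (simp_all add: csc_add_right csc_add_left csc_csc csc_one)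

definition clin :: "('a::cvector \<Rightarrow> 'b::cvector) \<Rightarrow> bool" where
  "clin f \<longleftrightarrow> (\<forall>x y. f (x + y) = f x + f y) \<and> (\<forall>a x. f (a *\<^sub>c x) = a *\<^sub>c f x)"

definition ctrace :: "('a::cvector \<Rightarrow> 'a) \<Rightarrow> 'a set \<Rightarrow> complex" where
  "ctrace f W = (let B = (SOME B. B \<subseteq> W \<and> \<not> module.dependent csc B \<and> module.span csc B = W)
                 in \<Sum>b\<in>B. module.representation csc B (f b) b)"

definition fsum :: "('i \<Rightarrow> 'a::comm_monoid_add) \<Rightarrow> 'a" where
  "fsum f = sum f {i. f i \<noteq> 0}"

text \<open>\<open>Y a n b\<close> is the mode \<open>a(n)b\<close>; \<open>L n = \<omega>(n+1)\<close>.\<close>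
definition Lop :: "('v \<Rightarrow> int \<Rightarrow> 'v \<Rightarrow> 'v) \<Rightarrow> 'v \<Rightarrow> int \<Rightarrow> 'v \<Rightarrow> 'v" where
  "Lop Y om n = Y om (n + 1)"

definition wtsp :: "('v::cvector \<Rightarrow> int \<Rightarrow> 'v \<Rightarrow> 'v) \<Rightarrow> 'v \<Rightarrow> int \<Rightarrow> 'v set" where
  "wtsp Y om w = {v. Lop Y om 0 v = of_int w *\<^sub>c v}"

definition is_voa :: "('v::cvector \<Rightarrow> int \<Rightarrow> 'v \<Rightarrow> 'v) \<Rightarrow> 'v \<Rightarrow> 'v \<Rightarrow> complex \<Rightarrow> bool" where
  "is_voa Y vac om c \<longleftrightarrow>
     (\<forall>a n. clin (Y a n)) \<and> (\<forall>b n. clin (\<lambda>a. Y a n b)) \<and>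
     \<comment> \<open>truncation\<close>
     (\<forall>a b. \<exists>N. \<forall>n\<ge>N. Y a n b = 0) \<and>
     \<comment> \<open>vacuum\<close>
     (\<forall>n b. Y vac n b = (if n = -1 then b else 0)) \<and>
     (\<forall>a n. n \<ge> 0 \<longrightarrow> Y a n vac = 0) \<and> (\<forall>a. Y a (-1) vac = a) \<and>
     \<comment> \<open>Jacobi identity, in the equivalent Borcherds (modes) form\<close>
     (\<forall>a b x p q r.
        fsum (\<lambda>i::nat. (of_int p gchoose i) *\<^sub>c Y (Y a (r + int i) b) (p + q - int i) x) =
        fsum (\<lambda>i::nat. ((-1) ^ i * (of_int r gchoose i)) *\<^sub>c
                (Y a (p + r - int i) (Y b (q + int i) x)
                 - ((-1::complex) powi r) *\<^sub>c Y b (q + r - int i) (Y a (p + int i) x)))) \<and>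
     \<comment> \<open>Virasoro relations with central charge c\<close>
     (\<forall>m n x. Lop Y om m (Lop Y om n x) - Lop Y om n (Lop Y om m x) =
        of_int (m - n) *\<^sub>c Lop Y om (m + n) x
        + (if m + n = 0 then ((of_int m ^ 3 - of_int m) / 12 * c) *\<^sub>c x else 0)) \<and>
     \<comment> \<open>L(-1)-derivative property\<close>
     (\<forall>a n x. Y (Lop Y om (-1) a) n x = (- of_int n) *\<^sub>c Y a (n - 1) x) \<and>
     \<comment> \<open>grading: V is the direct sum of the L(0)-eigenspaces V_w (w integer),
         each finite-dimensional, and V_w = 0 for w sufficiently small\<close>
     (\<forall>v. \<exists>f :: int \<Rightarrow> 'v. finite {w. f w \<noteq> 0} \<and> (\<forall>w. f w \<in> wtsp Y om w)
            \<and> v = sum f {w. f w \<noteq> 0}) \<and>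
     (\<forall>w. \<exists>B. finite B \<and> module.span csc B = wtsp Y om w) \<and>
     (\<exists>N. \<forall>w<N. wtsp Y om w = {0})"

definition is_invol_aut :: "('v::cvector \<Rightarrow> int \<Rightarrow> 'v \<Rightarrow> 'v) \<Rightarrow> 'v \<Rightarrow> 'v \<Rightarrow> ('v \<Rightarrow> 'v) \<Rightarrow> bool" where
  "is_invol_aut Y vac om t \<longleftrightarrow> clin t \<and> bij t \<and> t vac = vac \<and> t om = om \<and>
     (\<forall>a n b. t (Y a n b) = Y (t a) n (t b)) \<and> (\<forall>x. t (t x) = x)"

definition wcomp :: "('v::cvector \<Rightarrow> int \<Rightarrow> 'v \<Rightarrow> 'v) \<Rightarrow> 'v \<Rightarrow> 'v \<Rightarrow> int \<Rightarrow> 'v" where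
  "wcomp Y om v = (THE f. finite {w. f w \<noteq> 0} \<and> (\<forall>w. f w \<in> wtsp Y om w)
                      \<and> v = sum f {w. f w \<noteq> 0})"

definition zmode :: "('v::cvector \<Rightarrow> int \<Rightarrow> 'v \<Rightarrow> 'v) \<Rightarrow> 'v \<Rightarrow> 'v \<Rightarrow> 'v \<Rightarrow> 'v" where
  "zmode Y om v x = (\<Sum>w | wcomp Y om v w \<noteq> 0. Y (wcomp Y om v w) (w - 1) x)"

text \<open>For v of weight w: Y[v,z] = e^{zw} Y(v, e^z - 1) = \<Sum>_k v(k) e^{zw}(e^z-1)^{-k-1};
  the coefficient of z^{-m-1} in e^{zw}(e^z-1)^{-k-1} (a formal Laurent series in z).\<close>
definition sqcoef :: "int \<Rightarrow> int \<Rightarrow> int \<Rightarrow> complex" where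
  "sqcoef w k m = fls_nth (fps_to_fls (fps_exp (of_int w)) *
                           (fps_to_fls (fps_exp 1 - 1)) powi (- k - 1)) (- m - 1)"

definition sqmode :: "('v::cvector \<Rightarrow> int \<Rightarrow> 'v \<Rightarrow> 'v) \<Rightarrow> 'v \<Rightarrow> 'v \<Rightarrow> int \<Rightarrow> 'v \<Rightarrow> 'v" where
  "sqmode Y om u m x = (\<Sum>w | wcomp Y om u w \<noteq> 0.
      fsum (\<lambda>k. sqcoef w k m *\<^sub>c Y (wcomp Y om u w) k x))"

text \<open>Z_W(x,\<tau>) = Tr_W o(x) q^{L(0)-c/24}, as the formal Laurent series in q whose
  coefficient of q^n is Tr_{W \<inter> V_n} o(x) (the common factor q^{-c/24} is omitted).\<close>
definition Zq :: "('v::cvector \<Rightarrow> int \<Rightarrow> 'v \<Rightarrow> 'v) \<Rightarrow> 'v \<Rightarrow> 'v set \<Rightarrow> 'v \<Rightarrow> complex fls" where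
  "Zq Y om W x = Abs_fls (\<lambda>n. ctrace (zmode Y om x) (W \<inter> wtsp Y om n))"

text \<open>Tr_V o(u) o(v) q^{L(0)-c/24}, with the factor q^{-c/24} omitted.\<close>
definition Zq2 :: "('v::cvector \<Rightarrow> int \<Rightarrow> 'v \<Rightarrow> 'v) \<Rightarrow> 'v \<Rightarrow> 'v \<Rightarrow> 'v \<Rightarrow> complex fls" where
  "Zq2 Y om u v = Abs_fls (\<lambda>n. ctrace (zmode Y om u \<circ> zmode Y om v) (wtsp Y om n))"

fun bern :: "nat \<Rightarrow> real" where
  "bern n = (if n = 0 then 1 else
     - (\<Sum>j<n. real ((n + 1) choose j) * bern j) / real (n + 1))"

definition divsig :: "nat \<Rightarrow> nat \<Rightarrow> complex" where
  "divsig k n = (\<Sum>d | d dvd n. of_nat d ^ k)"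

definition Eis :: "nat \<Rightarrow> complex fps" where
  "Eis k = Abs_fps (\<lambda>j. if odd k then 0
       else if j = 0 then - of_real (bern k) / fact k
       else 2 / fact (k - 1) * divsig (k - 1) j)"

definition Eis2 :: "nat \<Rightarrow> complex fps" where
  "Eis2 k = Abs_fps (\<lambda>j. if even j then fps_nth (Eis k) (j div 2) else 0)"

definition Fis :: "nat \<Rightarrow> complex fps" where
  "Fis k = 2 * Eis2 k - Eis k"

end

theory Submission
  imports Defs
begin

text \<open>
  Write \<open>u\<^sub>j\<close> for the mode of \<open>u\<close> that lowers weights by \<open>j\<close>, and \<open>T\<^sup>\<plusminus>\<^sub>N(j)\<close> for the trace of
  \<open>u\<^sub>j v\<^sub>-\<^sub>j\<close> on the weight space \<open>V\<^sup>\<plusminus>\<^sub>N\<close>. The modes of \<open>u\<close> and \<open>v\<close> exchange \<open>V\<^sup>+\<close> and \<open>V\<^sup>-\<close>, so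
  cyclicity of the trace and the commutator formula give
  \<open>T\<^sup>\<plusminus>\<^sub>N(j) - T\<^sup>\<mp>\<^sub>N\<^sub>-\<^sub>j(j) = \<Sum>\<^sub>m j\<^sup>m / m! Tr o(u[m]v)\<close>. Since weights are bounded below, iterating this
  expresses every \<open>T\<^sup>\<plusminus>\<^sub>N(j)\<close> with \<open>j \<noteq> 0\<close> by traces of the \<open>o(u[m]v)\<close>: the steps alternate between
  \<open>V\<^sup>+\<close> and \<open>V\<^sup>-\<close>, which is where the alternating divisor sums of \<open>F\<^sub>k\<close> come from. On the other hand the
  Borcherds identity writes \<open>o(u[-n]v)\<close> through the products \<open>u\<^sub>j v\<^sub>-\<^sub>j\<close> with \<open>j < 0\<close> and
  \<open>v\<^sub>-\<^sub>j u\<^sub>j\<close> with \<open>j \<ge> 0\<close>, weighted by \<open>(-j)\<^sup>n\<^sup>-\<^sup>1 / (n - 1)!\<close>, and through the \<open>o(u[m]v)\<close>, weighted by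
  Bernoulli numbers. The latter weights result from a residue computation with
  \<open>e\<^sup>z (e\<^sup>z - 1)\<^sup>-\<^sup>r\<^sup>-\<^sup>1\<close> and supply the constant terms of \<open>F\<^sub>k\<close>.
\<close>

section \<open>Power series of \<open>e\<^sup>z - 1\<close> and Bernoulli numbers\<close>

unbundle fps_syntax

declare bern.simps [simp del]

text \<open>The vanishing of \<open>g\<close> below \<open>N - K\<close> makes the convolution
  finite: shifting \<open>g\<close> by that amount gives a power series, to which the Cauchy product
  applies. It serves both for series in z and for series in q.\<close>

lemma fps_to_fls_times_nth:
  fixes g :: "complex fls"
  assumes "\<And>i. i < N - int K \<Longrightarrow> g $$ i = 0"
  shows "(fps_to_fls F * g) $$ N = (\<Sum>p\<le>K. F $ p * g $$ (N - int p))"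
proof -
  define G where "G = Abs_fps (\<lambda>i. g $$ (N - int K + int i))"
  have g: "g = fls_shift (int K - N) (fps_to_fls G)"
    using assms by (intro fls_eqI) (auto simp: G_def)
  have "(fps_to_fls F * g) $$ N = (F * G) $ K"
    by (subst g) (simp add: fls_shifted_times_simps(1) flip: fls_times_fps_to_fls)
  also have "\<dots> = (\<Sum>p\<le>K. F $ p * g $$ (N - int p))"
    unfolding fps_mult_nth atLeast0AtMost
    by (intro sum.cong) (auto simp: G_def of_nat_diff intro!: arg_cong[where f = "fls_nth g"])
  finally show ?thesis .
qed

section \<open>The kernels e^(cz) (e^z - 1)^(-k-1)\<close>

definition expm1 :: "complex fls" where "expm1 = fps_to_fls (fps_exp 1 - 1)"

text \<open>For \<open>c\<close> the weight of a vector, this is the kernel that turns the mode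
  \<open>k\<close> into square bracket modes. An arbitrary complex \<open>c\<close> allows exponents
  to be shifted freely.\<close>

definition qker :: "complex \<Rightarrow> int \<Rightarrow> complex fls" where
  "qker c k = fps_to_fls (fps_exp c) * expm1 powi (- k - 1)"

lemma sqcoef_qker: "sqcoef w k m = qker (of_int w) k $$ (- m - 1)"
  by (simp add: sqcoef_def qker_def expm1_def)

lemma expm1_nth_1: "expm1 $$ 1 = 1"
  by (simp add: expm1_def)

lemma expm1_nonzero [simp]: "expm1 \<noteq> 0"
  using expm1_nth_1 by auto

lemma subdegree_expm1 [simp]: "fls_subdegree expm1 = 1"
  by (rule fls_subdegree_eqI) (auto simp: expm1_def not_le)

lemma expm1_add_1: "expm1 + 1 = fps_to_fls (fps_exp 1)"
  by (simp add: expm1_def fps_to_fls_minus)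

lemma fls_exp_add: "fps_to_fls (fps_exp (a + b)) = fps_to_fls (fps_exp (a::complex)) * fps_to_fls (fps_exp b)"
  by (simp add: fps_exp_add_mult fls_times_fps_to_fls)

lemma subdegree_exp [simp]: "fls_subdegree (fps_to_fls (fps_exp (c::complex))) = 0"
  by (rule fls_subdegree_eqI) auto

lemma subdegree_qker [simp]: "fls_subdegree (qker c k) = - k - 1"
  unfolding qker_def by (subst fls_subdegree_mult) (auto simp: fps_to_fls_eq_0_iff)

lemma qker_nth_eq_0: "i < - k - 1 \<Longrightarrow> qker c k $$ i = 0"
  by (rule fls_eq0_below_subdegree) simp

lemma sqcoef_eq_0: "m > k \<Longrightarrow> sqcoef w k m = 0"
  by (simp add: sqcoef_qker qker_nth_eq_0)

lemma deriv_exp: "fls_deriv (fps_to_fls (fps_exp c)) = fls_const c * fps_to_fls (fps_exp (c::complex))"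
  by (simp add: fls_deriv_fps_to_fls fls_times_fps_to_fls)

lemma deriv_expm1_inverse_power:
  "fls_deriv (expm1 powi (- int k)) = - of_nat k * fps_to_fls (fps_exp 1) * expm1 powi (- int k - 1)"
proof -
  have d: "fls_deriv expm1 = fps_to_fls (fps_exp 1)"
    by (simp add: expm1_def fls_deriv_fps_to_fls)
  have "fls_deriv (inverse expm1 ^ k) = of_nat k * inverse expm1 ^ (k - 1) *
      (- inverse expm1 * fps_to_fls (fps_exp 1) * inverse expm1)"
    by (simp add: fls_deriv_power fls_inverse_deriv_divring d)
  also have "\<dots> = - of_nat k * fps_to_fls (fps_exp 1) * inverse expm1 ^ (k + 1)"
    by (cases k) (simp_all add: algebra_simps)
  also have "inverse expm1 ^ (k + 1) = expm1 powi (- int k - 1)"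
    by (simp add: power_int_def power_inverse nat_add_distrib)
  finally show ?thesis
    by (simp add: power_int_minus power_inverse)
qed

lemma qker_add: "qker (a + b) k = fps_to_fls (fps_exp a) * qker b k"
  by (simp add: qker_def fls_exp_add mult.assoc)

lemma qker_Suc: "qker c (int k + 1) = fps_to_fls (fps_exp c) * expm1 powi (- int k - 2)"
proof -
  have "- (int k + 1) - 1 = - int k - 2" by simp
  then show ?thesis by (simp only: qker_def)
qed

text \<open>Differentiating the power of e^z - 1 produces a factor e^z, which raises
  \<open>c\<close> and \<open>k\<close> together.\<close>

lemma deriv_qker:
  "fls_deriv (qker c (int k)) = fls_const c * qker c (int k) - of_nat (k + 1) * qker (c + 1) (int k + 1)"
proof -
  have "- int (k + 1) = - int k - 1" "- int (k + 1) - 1 = - int k - 2" by simp_all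
  then have "fls_deriv (expm1 powi (- int k - 1)) = - of_nat (k + 1) * fps_to_fls (fps_exp 1) * expm1 powi (- int k - 2)"
    using deriv_expm1_inverse_power[of "k + 1"] by (simp only:)
  then show ?thesis
    by (simp add: qker_Suc qker_def[of _ "int k"] deriv_exp fls_exp_add ring_distribs mult_ac)
qed

text \<open>By e^(2z) = (e^z - 1) e^z + e^z the term with exponent 2 falls back to exponent 1, so
  the kernels with \<open>c = 1\<close> are closed under differentiation.\<close>

lemma deriv_qker_1:
  "fls_deriv (qker 1 (int k)) = - of_nat k * qker 1 (int k) - of_nat (k + 1) * qker 1 (int k + 1)"
proof -
  have "qker 2 (int k + 1) = (expm1 + 1) * qker 1 (int k + 1)"
    using qker_add[of 1 1] by (simp add: expm1_add_1)
  also have "- int k - 2 + 1 = - int k - 1" by simp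
  then have "expm1 powi (- int k - 1) = expm1 powi (- int k - 2) * expm1"
    by (metis power_int_add_1 expm1_nonzero)
  then have "expm1 * qker 1 (int k + 1) = qker 1 (int k)"
    by (simp add: qker_Suc qker_def[of _ "int k"] mult_ac)
  then have "(expm1 + 1) * qker 1 (int k + 1) = qker 1 (int k) + qker 1 (int k + 1)"
    by (simp add: algebra_simps)
  finally show ?thesis using deriv_qker[of 1 k] by (simp add: ring_distribs)
qed

lemma qker_lead: "qker c k $$ (- k - 1) = 1"
proof -
  have inv: "(inverse expm1) $$ (-1) = 1"
    using fls_times_base[of expm1 "inverse expm1"] expm1_nth_1 by simp
  have P: "(expm1 ^ n) $$ int n = 1" for n
  proof (induction n)
    case (Suc n)
    then show ?case using fls_times_base[of expm1 "expm1 ^ n"] expm1_nth_1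
      by (simp add: fls_subdegree_pow)
  qed simp
  have I: "(inverse expm1 ^ n) $$ (- int n) = 1" for n
  proof (induction n)
    case (Suc n)
    then show ?case using fls_times_base[of "inverse expm1" "inverse expm1 ^ n"] inv
      by (simp add: fls_subdegree_pow)
  qed simp
  have "(expm1 powi j) $$ j = 1" for j
    using P[of "nat j"] I[of "nat (-j)"] by (cases "j \<ge> 0") (auto simp: power_int_def)
  then show ?thesis
    using fls_times_base[of "fps_to_fls (fps_exp c)" "expm1 powi (- k - 1)"] by (simp add: qker_def)
qed

text \<open>With x = e^z - 1 this is the residue of (1 + x)^c x^(-k-1). The proof avoids the
  substitution: a derivative has no residue, so \<open>deriv_qker\<close> gives a recursion in
  \<open>k\<close>, which is the absorption identity for binomial coefficients.\<close>

lemma residue_qker: "qker (c + 1) (int k) $$ -1 = c gchoose k"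
proof (induction k arbitrary: c)
  case 0
  show ?case using qker_lead[of "c+1" 0] by simp
next
  case (Suc k)
  have "0 = fls_deriv (qker c (int k)) $$ -1" by simp
  also have "\<dots> = c * (qker c (int k) $$ -1) - of_nat (k + 1) * (qker (c + 1) (int (Suc k)) $$ -1)"
    unfolding deriv_qker fls_of_nat by (simp add: algebra_simps)
  also have "qker c (int k) $$ -1 = (c - 1) gchoose k" using Suc[of "c - 1"] by simp
  also have "c * \<dots> = of_nat (k + 1) * (c gchoose Suc k)"
    using gbinomial_absorption[of k c] by simp
  finally have "of_nat (k + 1) * (c gchoose Suc k) = of_nat (k + 1) * (qker (c + 1) (int (Suc k)) $$ -1)" by simp
  then show ?case by (metis mult_cancel_left of_nat_eq_0_iff add_is_0 one_neq_zero)
qed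

text \<open>The composite has constant term 1 and satisfies f' = c f, which determines the
  exponential series.\<close>

lemma fps_exp_eq_binomial_compose: "fps_exp c = fps_binomial c oo (fps_exp 1 - 1 :: complex fps)"
proof -
  have "fps_deriv (fps_binomial c) * (1 + fps_X) = fps_const c * fps_binomial c"
    unfolding fps_binomial_deriv
    by (rule fps_divide_times_eq[THEN trans] | simp)+
  then have "(fps_deriv (fps_binomial c) * (1 + fps_X)) oo (fps_exp 1 - 1) = (fps_const c * fps_binomial c) oo (fps_exp 1 - 1 :: complex fps)"
    by simp
  then have "(fps_deriv (fps_binomial c) oo (fps_exp 1 - 1)) * fps_exp 1 = fps_const c * (fps_binomial c oo (fps_exp 1 - 1))"
    by (simp add: fps_compose_mult_distrib fps_compose_add_distrib)
  then have "fps_deriv (fps_binomial c oo (fps_exp 1 - 1)) = fps_const c * (fps_binomial c oo (fps_exp 1 - 1))"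
    by (simp add: fps_compose_deriv)
  then show ?thesis by (subst (asm) fps_exp_unique_ODE) simp
qed

text \<open>The factor \<open>e\<^sup>(\<^sup>c\<^sup>-\<^sup>1\<^sup>)\<^sup>z\<close> is expanded in powers of \<open>e\<^sup>z - 1\<close>.\<close>
lemma qker_expand:
  assumes "m \<le> k"
  shows "qker c k $$ (- m - 1) = (\<Sum>r\<in>{m..k}. qker 1 r $$ (- m - 1) * ((c - 1) gchoose nat (k - r)))"
proof -
  define K where "K = nat (k - m)"
  define X where "X = (fps_exp 1 - 1 :: complex fps)"
  \<comment> \<open>The expansion is cut off after the power \<open>K = k - m\<close>. The remainder
    \<open>R\<close> starts beyond degree \<open>K\<close>, hence \<open>R * qker 1 k\<close> starts
    beyond degree \<open>- m - 1\<close> and does not contribute.\<close>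
  define R where "R = fps_exp (c - 1) - (\<Sum>i\<le>K. fps_const ((c - 1) gchoose i) * X ^ i)"
  have R0: "R $ p = 0" if "p \<le> K" for p
  proof -
    have "fps_exp (c - 1) $ p = (\<Sum>i\<le>p. ((c-1) gchoose i) * (X ^ i $ p))"
      unfolding fps_exp_eq_binomial_compose[of "c - 1"]
      by (simp add: fps_compose_nth X_def atLeast0AtMost)
    also have "\<dots> = (\<Sum>i\<le>K. ((c-1) gchoose i) * (X ^ i $ p))"
      using that startsby_zero_power_prefix[of X] by (intro sum.mono_neutral_left) (auto simp: X_def)
    finally show ?thesis by (simp add: R_def fps_sum_nth)
  qed
  have "fps_to_fls (fps_exp (c - 1)) = fps_to_fls R + (\<Sum>i\<le>K. fls_const ((c - 1) gchoose i) * expm1 ^ i)"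
  proof -
    have s: "fps_to_fls (sum f A) = (\<Sum>i\<in>A. fps_to_fls (f i))" for f :: "nat \<Rightarrow> complex fps" and A
      by (induction A rule: infinite_finite_induct) auto
    have "fps_exp (c - 1) = R + (\<Sum>i\<le>K. fps_const ((c - 1) gchoose i) * X ^ i)" by (simp add: R_def)
    then show ?thesis
      by (simp only: fps_to_fls_plus s fls_times_fps_to_fls fps_to_fls_power fps_const_to_fls X_def expm1_def)
  qed
  then have "qker c k = fps_to_fls R * qker 1 k + (\<Sum>i\<le>K. fls_const ((c - 1) gchoose i) * (expm1 ^ i * qker 1 k))"
    using qker_add[of "c - 1" 1 k] by (simp add: distrib_right sum_distrib_right mult.assoc)
  also have "(\<lambda>i. expm1 ^ i * qker 1 k) = (\<lambda>i. qker 1 (k - int i))"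
    by (rule ext) (use power_int_add[of expm1 "int _" "-k-1"] in \<open>simp add: qker_def mult_ac algebra_simps\<close>)
  finally have "qker c k $$ (- m - 1) = (fps_to_fls R * qker 1 k) $$ (- m - 1)
     + (\<Sum>i\<le>K. ((c - 1) gchoose i) * qker 1 (k - int i) $$ (- m - 1))"
    by (simp add: fls_nth_sum)
  also have "(fps_to_fls R * qker 1 k) $$ (- m - 1) = (\<Sum>p\<le>K. R $ p * qker 1 k $$ (- m - 1 - int p))"
    by (rule fps_to_fls_times_nth) (use assms in \<open>auto simp: K_def qker_nth_eq_0\<close>)
  also have "\<dots> = 0" using R0 by simp
  also have "(\<Sum>i\<le>K. ((c - 1) gchoose i) * qker 1 (k - int i) $$ (- m - 1))
     = (\<Sum>r\<in>{m..k}. qker 1 r $$ (- m - 1) * ((c - 1) gchoose nat (k - r)))"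
    by (rule sum.reindex_bij_witness[where i = "\<lambda>r. nat (k - r)" and j = "\<lambda>i. k - int i"])
       (use assms in \<open>auto simp: K_def\<close>)
  finally show ?thesis by simp
qed

text \<open>The dependence on the weight moves into binomial coefficients, namely those on the left
  of the Borcherds identity with p = w - 1; only the universal coefficients of weight 1
  remain.\<close>

lemma sqcoef_expand:
  assumes "m \<le> k"
  shows "sqcoef w k m = (\<Sum>r\<in>{m..k}. sqcoef 1 r m * ((of_int w - 1) gchoose nat (k - r)))"
  using qker_expand[OF assms, of "of_int w"] by (simp add: sqcoef_qker)

text \<open>Both sides are the residue of e^(sz) e^(wz) (e^z - 1)^(-K-1): on the left e^(sz) is
  expanded, on the right \<open>residue_qker\<close> is applied to the product.\<close>

lemma sum_sqcoef_powers:
  "(\<Sum>m\<le>K. of_int s ^ m / fact m * sqcoef w (int K) (int m)) = (of_int (w - 1 + s) gchoose K)"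
proof -
  have "(of_int (w - 1 + s) gchoose K) = qker (of_int s + of_int w) (int K) $$ -1"
    using residue_qker[of "of_int (w - 1 + s)" K] by (simp add: algebra_simps)
  also have "\<dots> = (\<Sum>m\<le>K. fps_exp (of_int s) $ m * qker (of_int w) (int K) $$ (-1 - int m))"
    unfolding qker_add by (rule fps_to_fls_times_nth) (simp add: qker_nth_eq_0)
  finally show ?thesis by (simp add: sqcoef_qker minus_diff_commute)
qed

lemma sum_sqcoef_gchoose:
  assumes "n \<ge> 1"
  shows "(\<Sum>s<n. sqcoef 1 (- int s - 1) (- int n) * (of_int (- j - 1) gchoose s)) = of_int (- j) ^ (n - 1) / fact (n - 1)"
proof -
  \<comment> \<open>For \<open>k = -1\<close> no power of e^z - 1 is left, so the kernel of weight
    \<open>- j\<close> is e^(-jz); its coefficient is then expanded by weight 1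
    coefficients.\<close>
  have "of_int (- j) ^ (n - 1) / fact (n - 1) = sqcoef (- j) (-1) (- int n)"
    using assms by (simp add: sqcoef_qker qker_def nat_diff_distrib)
  also have "\<dots> = (\<Sum>r\<in>{- int n.. -1}. sqcoef 1 r (- int n) * ((of_int (- j) - 1) gchoose nat (-1 - r)))"
    by (rule sqcoef_expand) (use assms in auto)
  also have "\<dots> = (\<Sum>s<n. sqcoef 1 (- int s - 1) (- int n) * (of_int (- j - 1) gchoose s))"
    by (rule sum.reindex_bij_witness[where j = "\<lambda>r. nat (-1 - r)" and i = "\<lambda>i. - int i - 1"]) auto
  finally show ?thesis by simp
qed

section \<open>Bernoulli numbers and the series z / (e^z - 1)\<close>

definition bern_fps :: "complex fps" where
  "bern_fps = Abs_fps (\<lambda>k. of_real (bern k) / fact k)"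

lemma bern_0 [simp]: "bern 0 = 1"
  by (simp add: bern.simps)

lemma sum_bern:
  assumes "n \<ge> 1"
  shows "(\<Sum>j\<le>n. real (Suc n choose j) * bern j) = 0"
proof -
  have "bern n = - (\<Sum>j<n. real ((n + 1) choose j) * bern j) / real (n + 1)"
    using assms by (subst bern.simps) simp
  then have "real (n + 1) * bern n = - (\<Sum>j<n. real ((n + 1) choose j) * bern j)"
    by (simp add: field_simps)
  then show ?thesis by (simp add: lessThan_Suc_atMost[symmetric])
qed

text \<open>From degree 2 on, the coefficient of the product is a multiple of the sum that the
  recursion for \<open>bern\<close> sets to zero.\<close>

lemma bern_fps_times: "bern_fps * (fps_exp 1 - 1) = fps_X"
proof (rule fps_ext)
  fix n
  have "(bern_fps * (fps_exp 1 - 1)) $ n = (\<Sum>i<n. of_real (bern i) / fact i * (1 / fact (n - i)))"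
    unfolding fps_mult_nth atLeast0AtMost lessThan_Suc_atMost[symmetric] sum.lessThan_Suc
    by (auto simp: bern_fps_def intro!: sum.cong)
  also have "\<dots> = (\<Sum>i<n. of_real (real (n choose i) * bern i)) / fact n"
    unfolding sum_divide_distrib
    by (intro sum.cong) (auto simp: binomial_fact field_simps)
  also have "\<dots> = fps_X $ n"
  proof (cases "n \<ge> 2")
    case True
    then have "(\<Sum>i<n. real (n choose i) * bern i) = 0"
      using sum_bern[of "n - 1"] by (simp add: lessThan_Suc_atMost[symmetric])
    then show ?thesis using True by (simp flip: of_real_sum of_real_mult del: of_real_mult of_real_of_nat_eq)
  next
    case False
    then have "n = 0 \<or> n = 1" by auto
    then show ?thesis by auto
  qed
  finally show "(bern_fps * (fps_exp 1 - 1)) $ n = fps_X $ n" .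
qed

text \<open>Replace z by -z in \<open>bern_fps_times\<close> and multiply by e^z.\<close>

lemma bern_fps_minus_times: "(bern_fps oo - fps_X) * (fps_exp 1 - 1) = fps_X * fps_exp 1"
proof -
  have e: "fps_exp (- 1) * fps_exp 1 = (1 :: complex fps)"
    by (simp flip: fps_exp_add_mult)
  have "(bern_fps oo - fps_X) * (fps_exp (- 1) - 1) = - fps_X"
    using arg_cong[OF bern_fps_times, of "\<lambda>f. f oo - fps_X"]
    by (simp add: fps_compose_mult_distrib fps_compose_sub_distrib)
  then have "(bern_fps oo - fps_X) * (fps_exp (- 1) - 1) * fps_exp 1 = - fps_X * fps_exp 1" by simp
  then have "(bern_fps oo - fps_X) * (fps_exp (- 1) * fps_exp 1 - fps_exp 1) = - fps_X * fps_exp 1"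
    by (simp add: algebra_simps)
  then show ?thesis unfolding e by (simp add: algebra_simps add_eq_0_iff)
qed

lemma bern_fps_minus_nth: "(bern_fps oo - fps_X) $ k = (-1) ^ k * of_real (bern k) / fact k"
  by (simp add: fps_compose_uminus' bern_fps_def)

text \<open>The series z e^z / (e^z - 1) and z / (e^z - 1) differ by z, and the first arises from
  the second by z -> -z. The values at odd indices follow.\<close>

lemma bern_reflect: "(-1) ^ k * of_real (bern k) = of_real (bern k) + (if k = 1 then 1 else (0 :: complex))"
proof -
  have "((bern_fps oo - fps_X) - bern_fps) * (fps_exp 1 - 1) = fps_X * (fps_exp 1 - 1)"
    using bern_fps_times bern_fps_minus_times by (simp add: algebra_simps)
  moreover have "fps_exp 1 - 1 \<noteq> (0 :: complex fps)"
    using arg_cong[of "fps_exp 1 - 1 :: complex fps" 0 "\<lambda>f. f $ 1"] by auto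
  ultimately have "(bern_fps oo - fps_X) - bern_fps = fps_X" by simp
  from arg_cong[OF this, of "\<lambda>f. f $ k"] show ?thesis
    by (simp add: bern_fps_minus_nth) (simp add: bern_fps_def field_simps split: if_splits)
qed

lemma bern_odd:
  assumes "odd k" "k \<noteq> 1"
  shows "bern k = 0"
  using bern_reflect[of k] assms by (simp add: of_real_eq_0_iff eq_neg_iff_add_eq_0 flip: of_real_minus)

lemma bern_1: "bern 1 = - 1 / 2"
proof -
  have "of_real (bern 1) = - (1 / 2 :: complex)"
    using bern_reflect[of 1] by (simp add: field_simps add_eq_0_iff)
  also have "\<dots> = of_real (- 1 / 2)" by simp
  finally show ?thesis by (simp only: of_real_eq_iff)
qed

lemma X_times_qker: "fls_X * qker 1 0 = fps_to_fls (bern_fps oo - fps_X)"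
proof -
  have "fps_to_fls (bern_fps oo - fps_X) * expm1 = fls_X * fps_to_fls (fps_exp 1)"
    using arg_cong[OF bern_fps_minus_times, of fps_to_fls]
    by (simp add: expm1_def fls_times_fps_to_fls)
  then show ?thesis
    by (simp add: qker_def power_int_minus field_simps)
qed

section \<open>Negative square bracket coefficients from nonnegative ones\<close>

lemma higher_deriv_nth:
  "(fls_deriv ^^ j) f $$ i = pochhammer (of_int i + 1) j * (f $$ (i + int j) :: complex)"
proof (induction j arbitrary: i)
  case (Suc j)
  have "(fls_deriv ^^ Suc j) f $$ i = of_int (i + 1) * (fls_deriv ^^ j) f $$ (i + 1)" by simp
  also have "\<dots> = of_int (i + 1) * pochhammer (of_int i + 1 + 1) j * f $$ (i + int (Suc j))"
    by (simp add: Suc.IH algebra_simps)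
  also have "of_int (i + 1) * pochhammer (of_int i + 1 + 1) j = (pochhammer (of_int i + 1) (Suc j) :: complex)"
    by (simp add: pochhammer_rec)
  finally show ?case .
qed simp

lemma higher_deriv_linear:
  "(fls_deriv ^^ j) (fls_const a * f - fls_const b * g) =
     fls_const a * (fls_deriv ^^ j) f - fls_const b * (fls_deriv ^^ j) (g :: complex fls)"
  by (rule fls_eqI) (simp add: higher_deriv_nth algebra_simps)

text \<open>Integration by parts moves the derivatives onto the factor \<open>e\<^sup>z / (e\<^sup>z - 1)\<close>.\<close>
lemma residue_higher_deriv:
  "((fls_deriv ^^ j) (qker 1 (int r)) * qker 1 0) $$ -1 = (if j = 0 \<and> r = 0 then 1 else 0)"
proof (induction j arbitrary: r)
  case 0
  have gb: "(1 :: complex) gchoose (r + 1) = (if r = 0 then 1 else 0)"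
  proof -
    have "(1 :: nat) choose (r + 1) = (if r = 0 then 1 else 0)" by (cases r) auto
    then show ?thesis using binomial_gbinomial[of 1 "r + 1", where ?'a = complex]
      by (metis of_nat_0 of_nat_1)
  qed
  \<comment> \<open>In the base case the two kernels multiply to a single one with exponent 2, whose
    residue is the binomial coefficient 1 over \<open>r + 1\<close>.\<close>
  have "- (int r) - 2 = (- int r - 1) + (- 1)" by simp
  then have "expm1 powi (- int r - 2) = expm1 powi (- int r - 1) * inverse expm1"
    by (metis power_int_add power_int_minus power_int_1_right expm1_nonzero)
  then have "qker 1 (int r) * qker 1 0 = qker 2 (int r + 1)"
    unfolding qker_Suc using fls_exp_add[of 1 1]
    by (simp add: qker_def mult_ac)
  then show ?case using residue_qker[of 1 "r + 1"] gb
    by (simp add: add.commute)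
next
  case (Suc j)
  have "(fls_deriv ^^ Suc j) (qker 1 (int r)) = (fls_deriv ^^ j) (fls_deriv (qker 1 (int r)))"
    by (simp only: funpow_Suc_right o_apply)
  also have "fls_deriv (qker 1 (int r)) = fls_const (- of_nat r) * qker 1 (int r) - fls_const (of_nat (r + 1)) * qker 1 (int (r + 1))"
    using deriv_qker_1[of r] by (simp add: fls_of_nat algebra_simps)
  finally have E: "(fls_deriv ^^ Suc j) (qker 1 (int r)) =
      fls_const (- of_nat r) * (fls_deriv ^^ j) (qker 1 (int r)) - fls_const (of_nat (r + 1)) * (fls_deriv ^^ j) (qker 1 (int (r + 1)))"
    by (simp only: higher_deriv_linear)
  have "((fls_deriv ^^ Suc j) (qker 1 (int r)) * qker 1 0) $$ -1
     = - of_nat r * ((fls_deriv ^^ j) (qker 1 (int r)) * qker 1 0) $$ -1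
       - of_nat (r + 1) * ((fls_deriv ^^ j) (qker 1 (int (r + 1))) * qker 1 0) $$ -1"
    unfolding E by (simp add: left_diff_distrib mult.assoc)
  then show ?case unfolding Suc.IH by auto
qed

text \<open>The residue of \<open>f * qker 1 0\<close>, with \<open>f\<close> the derivative of
  order \<open>n - 1\<close> of \<open>qker 1 r\<close>, is evaluated twice: by
  \<open>residue_higher_deriv\<close>, and by expanding \<open>qker 1 0\<close> into Bernoulli
  numbers. In the expansion the constant term of \<open>f\<close> carries the coefficient for
  \<open>- n\<close>, and its terms of degree \<open>- (n + m)\<close> carry those for
  \<open>m\<close>.\<close>

lemma sqcoef_reflect:
  assumes "n \<ge> 1"
  shows "sqcoef 1 (int r) (- int n) =
     (\<Sum>m\<le>r. (-1) ^ m * of_nat ((n + m - 1) choose m) * of_real (bern (n + m)) / fact (n + m) * sqcoef 1 (int r) (int m))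
     + (if n = 1 \<and> r = 0 then 1 else 0)"
proof -
  define j where "j = n - 1"
  then have n: "n = Suc j" using assms by simp
  define f where "f = (fls_deriv ^^ j) (qker 1 (int r))"
  define K where "K = r + j + 1"
  have f0: "f $$ i = 0" if "i < - int K" for i
    using that by (simp add: f_def higher_deriv_nth qker_nth_eq_0 K_def)
  have f00: "f $$ 0 = fact j * sqcoef 1 (int r) (- int n)"
    by (simp add: f_def higher_deriv_nth sqcoef_qker n pochhammer_fact)
  \<comment> \<open>A derivative of order \<open>j\<close> has no terms of degree -1 to
    \<open>- j\<close>, so no index strictly between \<open>- n\<close> and 0 enters.\<close>
  have fneg: "f $$ (- int p) = 0" if "1 \<le> p" "p \<le> j" for p
    using that by (auto simp: f_def higher_deriv_nth pochhammer_eq_0_iff intro!: exI[of _ "p - 1"])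
  have fpole: "f $$ (- int (j + 1 + m)) = (-1) ^ j * (fact (j + m) / fact m) * sqcoef 1 (int r) (int m)" for m
  proof -
    have "pochhammer (of_int (- int (j + 1 + m)) + 1) j = (-1) ^ j * (pochhammer (of_nat m + 1) j :: complex)"
      using pochhammer_minus[of "of_nat (j + m)" j] by (simp add: algebra_simps)
    also have "pochhammer (of_nat m + 1) j = (fact (j + m) / fact m :: complex)"
      using pochhammer_product[of m "j + m" "1 :: complex"] by (simp add: pochhammer_fact[symmetric] add.commute)
    finally show ?thesis by (simp add: f_def higher_deriv_nth sqcoef_qker)
  qed
  \<comment> \<open>The factor \<open>qker 1 0\<close> has a simple pole; multiplication by z makes
    it the power series of Bernoulli numbers at -z and turns the residue into a constant
    term.\<close>
  have "(f * qker 1 0) $$ -1 = (fls_X * (qker 1 0 * f)) $$ 0"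
    by (simp add: fls_X_times_conv_shift mult.commute)
  also have "\<dots> = (fps_to_fls (bern_fps oo - fps_X) * f) $$ 0"
    by (simp add: X_times_qker flip: mult.assoc)
  also have "\<dots> = (\<Sum>p\<le>K. (bern_fps oo - fps_X) $ p * f $$ (0 - int p))"
    by (rule fps_to_fls_times_nth) (use f0 in auto)
  also have "\<dots> = f $$ 0 + (\<Sum>p\<in>{1..K}. (bern_fps oo - fps_X) $ p * f $$ (- int p))"
    by (subst sum.atMost_shift) (simp add: bern_fps_def sum.atLeast1_atMost_eq del: of_nat_Suc)
  also have "(\<Sum>p\<in>{1..K}. (bern_fps oo - fps_X) $ p * f $$ (- int p)) =
     (\<Sum>p\<in>{j + 1..K}. (bern_fps oo - fps_X) $ p * f $$ (- int p))"
    using fneg by (intro sum.mono_neutral_right) (auto simp: not_le less_Suc_eq_le)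
  also have "\<dots> = (\<Sum>m\<le>r. (bern_fps oo - fps_X) $ (j + 1 + m) * f $$ (- int (j + 1 + m)))"
    by (rule sum.reindex_bij_witness[where i = "\<lambda>m. j + 1 + m" and j = "\<lambda>p. p - (j + 1)"]) (auto simp: K_def)
  also have "\<dots> = - fact j * (\<Sum>m\<le>r. (-1) ^ m * of_nat ((n + m - 1) choose m) * of_real (bern (n + m)) / fact (n + m) * sqcoef 1 (int r) (int m))"
    unfolding sum_distrib_left
  proof (intro sum.cong refl)
    fix m
    have C: "fact (j + m) / fact m = fact j * (of_nat ((j + m) choose m) :: complex)"
      by (simp add: binomial_fact)
    have sgn: "(-1) ^ (j + 1 + m) * (-1) ^ j = (- ((-1) ^ m) :: complex)"
      by (simp add: power_add mult_ac flip: power_mult_distrib)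
    have ac: "e * b / D * (e' * F * s) = (e * e') * (F * (b / D * s))" for e e' b D F s :: complex
      by simp
    show "(bern_fps oo - fps_X) $ (j + 1 + m) * f $$ (- int (j + 1 + m)) = - fact j * ((-1) ^ m * of_nat ((n + m - 1) choose m) * of_real (bern (n + m)) / fact (n + m) * sqcoef 1 (int r) (int m))"
      unfolding fpole bern_fps_minus_nth n C ac sgn by simp
  qed
  finally have "(if j = 0 \<and> r = 0 then 1 else 0) = fact j * (sqcoef 1 (int r) (- int n) -
     (\<Sum>m\<le>r. (-1) ^ m * of_nat ((n + m - 1) choose m) * of_real (bern (n + m)) / fact (n + m) * sqcoef 1 (int r) (int m)))"
    using f00 residue_higher_deriv[of j r, folded f_def] by (simp add: algebra_simps)
  then show ?thesis
    by (cases "j = 0 \<and> r = 0") (auto simp: n algebra_simps)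
qed

lemma gchoose_neg: "(-1) ^ i * (of_int (- int s - 1) gchoose i) = (of_int (int (s + i)) gchoose s :: complex)"
proof -
  have "of_int (- int s - 1) = (- of_nat (s + 1) :: complex)"
    "of_nat (s + 1) + of_nat i - 1 = (of_nat (s + i) :: complex)" by simp_all
  then have "(of_int (- int s - 1) gchoose i) = (-1) ^ i * (of_nat (s + i) gchoose i :: complex)"
    using gbinomial_minus[of "of_nat (s + 1) :: complex" i] by (simp only:)
  also have "of_nat (s + i) gchoose i = (of_nat ((s + i) choose i) :: complex)"
    by (simp only: binomial_gbinomial)
  also have "(s + i) choose i = (s + i) choose s"
    using binomial_symmetric[of i "s + i"] by simp
  also have "of_nat ((s + i) choose s) = (of_nat (s + i) gchoose s :: complex)"
    by (simp only: binomial_gbinomial)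
  finally show ?thesis by (simp flip: power_mult_distrib)
qed

section \<open>Coefficients of the Eisenstein series\<close>

text \<open>The factor that turns F_(n+m) into (1/m) times the hatted F_(n+m); in this form it also
  makes sense for \<open>m = 0\<close>.\<close>

definition zcoef :: "nat \<Rightarrow> nat \<Rightarrow> complex" where
  "zcoef n m = (-1) ^ (m + 1) * of_nat ((n + m - 1) choose m)"

text \<open>For odd \<open>k\<close> this rests on the vanishing of odd Bernoulli numbers, which
  fails at \<open>k = 1\<close>; that index is responsible for the correction terms when
  \<open>n = 1\<close>.\<close>

lemma Fis_nth_0: "k \<ge> 2 \<Longrightarrow> Fis k $ 0 = - of_real (bern k) / fact k"
  by (auto simp: Fis_def Eis_def Eis2_def bern_odd)

lemma Fis_1: "Fis 1 = 0"
  by (rule fps_ext) (auto simp: Fis_def Eis_def Eis2_def numeral_fps_const)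

lemma Eis_odd: "odd k \<Longrightarrow> Eis k = 0"
  by (rule fps_ext) (auto simp: Eis_def)

lemma Fis_odd: "odd k \<Longrightarrow> Fis k = 0"
  by (rule fps_ext) (auto simp: Fis_def Eis2_def Eis_odd numeral_fps_const)

text \<open>The divisors of p/2 are the divisors \<open>l\<close> of \<open>p\<close> with even
  cofactor \<open>p div l\<close>.\<close>

lemma Eis2_nth:
  assumes "even k" "p \<ge> 1"
  shows "Eis2 k $ p = 2 / fact (k - 1) * (\<Sum>l | l dvd p. if even (p div l) then of_nat l ^ (k - 1) else 0)"
proof (cases "even p")
  case True
  have "{l. l dvd p div 2} = {l. l dvd p} \<inter> {l. even (p div l)}"
  proof -
    have "l dvd p div 2 \<longleftrightarrow> l dvd p \<and> even (p div l)" for l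
      using True assms(2) by (cases "l = 0") (auto elim!: dvdE simp: dvd_def)
    then show ?thesis by auto
  qed
  then have "(\<Sum>l | l dvd p. if even (p div l) then of_nat l ^ (k - 1) else 0) = divsig (k - 1) (p div 2)"
    using assms unfolding divsig_def by (simp add: sum.If_cases)
  then show ?thesis using True assms by (auto simp: Eis2_def Eis_def elim!: evenE)
next
  case False
  have "odd (p div l)" if "l dvd p" for l
    using False that by (metis dvd_div_mult_self dvd_mult2)
  then show ?thesis using False by (simp add: Eis2_def)
qed

lemma Eis_nth:
  assumes "even k" "p \<ge> 1"
  shows "Eis k $ p = 2 / fact (k - 1) * (\<Sum>l | l dvd p. of_nat l ^ (k - 1))"
  using assms by (simp add: Eis_def divsig_def)

text \<open>The sign depends on the parity of the cofactor \<open>p div l\<close>. In the trace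
  computation this cofactor counts the steps between V+ and V-.\<close>

lemma Fis_nth:
  assumes "even k" "p \<ge> 1"
  shows "Fis k $ p = 2 / fact (k - 1) * (\<Sum>l | l dvd p. if even (p div l) then of_nat l ^ (k - 1) else - (of_nat l ^ (k - 1)))"
proof -
  have "Fis k $ p = 2 * Eis2 k $ p - Eis k $ p"
    by (simp add: Fis_def numeral_fps_const)
  also have "\<dots> = 2 / fact (k - 1) * (\<Sum>l | l dvd p. 2 * (if even (p div l) then of_nat l ^ (k - 1) else 0) - of_nat l ^ (k - 1))"
    unfolding Eis2_nth[OF assms] Eis_nth[OF assms] sum_subtractf sum_distrib_left[symmetric] by (simp add: algebra_simps)
  also have "(\<Sum>l | l dvd p. 2 * (if even (p div l) then of_nat l ^ (k - 1) else 0) - of_nat l ^ (k - 1)) =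
      (\<Sum>l | l dvd p. if even (p div l) then of_nat l ^ (k - 1) else - (of_nat l ^ (k - 1) :: complex))"
    by (intro sum.cong) auto
  finally show ?thesis .
qed

lemma Eis_minus_Fis_nth:
  assumes "even k" "p \<ge> 1"
  shows "(Eis k - Fis k) $ p = 4 / fact (k - 1) * (\<Sum>l | l dvd p. if even (p div l) then 0 else of_nat l ^ (k - 1))"
proof -
  have "(Eis k - Fis k) $ p = 2 / fact (k - 1) * (\<Sum>l | l dvd p. of_nat l ^ (k - 1) - (if even (p div l) then of_nat l ^ (k - 1) else - (of_nat l ^ (k - 1))))"
    unfolding fps_sub_nth Eis_nth[OF assms] Fis_nth[OF assms] sum_subtractf by (simp add: algebra_simps)
  also have "(\<Sum>l | l dvd p. of_nat l ^ (k - 1) - (if even (p div l) then of_nat l ^ (k - 1) else - (of_nat l ^ (k - 1)))) =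
      2 * (\<Sum>l | l dvd p. if even (p div l) then 0 else of_nat l ^ (k - 1) :: complex)"
    unfolding sum_distrib_left by (intro sum.cong) auto
  finally show ?thesis by simp
qed

lemma Eis_minus_Fis_nth_0: "(Eis k - Fis k) $ 0 = 0"
  by (simp add: Fis_def Eis2_def numeral_fps_const)

text \<open>Pairs are grouped by their product, as for Lambert series; the vanishing assumption
  permits summation over a square of pairs.\<close>

lemma sum_divisor_pairs:
  fixes g :: "nat \<Rightarrow> nat \<Rightarrow> complex"
  assumes "\<And>l a. l * a > Q \<Longrightarrow> g l a = 0"
  shows "(\<Sum>l\<in>{1..Q}. \<Sum>a\<in>{1..Q}. g l a) = (\<Sum>p\<in>{1..Q}. \<Sum>l | l dvd p. g l (p div l))"
proof -
  have "(\<Sum>l\<in>{1..Q}. \<Sum>a\<in>{1..Q}. g l a) = (\<Sum>(l, a)\<in>{1..Q} \<times> {1..Q}. g l a)"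
    by (rule sum.cartesian_product)
  also have "\<dots> = (\<Sum>(l, a)\<in>{(l, a). 1 \<le> l \<and> 1 \<le> a \<and> l * a \<le> Q}. g l a)"
  proof (intro sum.mono_neutral_right ballI)
    show "{(l, a). 1 \<le> l \<and> 1 \<le> a \<and> l * a \<le> Q} \<subseteq> {1..Q} \<times> {1..Q}"
    proof clarsimp
      fix l a :: nat assume "Suc 0 \<le> l" "Suc 0 \<le> a" "l * a \<le> Q"
      moreover from this have "l \<le> l * a" "a \<le> l * a" by simp_all
      ultimately show "l \<le> Q \<and> a \<le> Q" by linarith
    qed
  next
    fix x assume "x \<in> {1..Q} \<times> {1..Q} - {(l, a). 1 \<le> l \<and> 1 \<le> a \<and> l * a \<le> Q}"
    then show "(case x of (l, a) \<Rightarrow> g l a) = 0" using assms[of "fst x" "snd x"] by (cases x) auto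
  qed simp
  also have "\<dots> = (\<Sum>(p, l)\<in>(SIGMA p:{1..Q}. {l. l dvd p}). g l (p div l))"
    by (rule sum.reindex_bij_witness[where i = "\<lambda>(p, l). (l, p div l)" and j = "\<lambda>(l, a). (l * a, l)"])
       (auto simp: Suc_le_eq elim!: dvdE)
  also have "\<dots> = (\<Sum>p\<in>{1..Q}. \<Sum>l | l dvd p. g l (p div l))"
    by (rule sum.Sigma[symmetric]) auto
  finally show ?thesis .
qed

text \<open>The two products belong to the modes \<open>l\<close> and \<open>- l\<close>. Their
  signs (-1)^(n-1) and (-1)^m cancel unless \<open>n + m\<close> is even, which is why only
  Eisenstein series of even weight appear.\<close>

lemma zcoef_power:
  assumes "n \<ge> 1"
  shows "(- of_nat l) ^ (n - 1) / fact (n - 1) * (of_nat l ^ m / fact m)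
    - of_nat l ^ (n - 1) / fact (n - 1) * ((- of_nat l) ^ m / fact m) =
    (if even (n + m) then zcoef n m * (2 / fact (n + m - 1) * of_nat l ^ (n + m - 1)) else (0 :: complex))"
proof -
  obtain j where n: "n = Suc j" using assms by (cases n) auto
  have b: "of_nat ((j + m) choose m) = (fact (j + m) / (fact m * fact j) :: complex)"
    by (simp add: binomial_fact)
  have e: "(- of_nat l) ^ i = (-1) ^ i * (of_nat l ^ i :: complex)" for i
    by (rule power_minus)
  have s: "(-1) ^ j - (-1) ^ m = (if even (n + m) then 2 * (-1) ^ (m + 1) else (0 :: complex))"
    by (auto simp: n uminus_power_if)
  have "(- of_nat l) ^ (n - 1) / fact (n - 1) * (of_nat l ^ m / fact m)
    - of_nat l ^ (n - 1) / fact (n - 1) * ((- of_nat l) ^ m / fact m) =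
    ((-1) ^ j - (-1) ^ m) * (of_nat l ^ (j + m) / (fact j * fact m) :: complex)"
    unfolding e n by (simp add: power_add field_simps)
  then show ?thesis
    unfolding s by (simp add: zcoef_def n b mult_ac)
qed

section \<open>Traces on finite-dimensional subspaces\<close>

interpretation csc: vector_space "csc :: complex \<Rightarrow> 'a::cvector \<Rightarrow> 'a"
  by (rule vector_space_csc)

definition findim :: "'a::cvector set \<Rightarrow> bool" where
  "findim W \<longleftrightarrow> csc.subspace W \<and> (\<exists>B. finite B \<and> W \<subseteq> csc.span B)"

definition cbasis :: "'a::cvector set \<Rightarrow> 'a set" where
  "cbasis W = (SOME B. B \<subseteq> W \<and> \<not> module.dependent csc B \<and> module.span csc B = W)"

lemma ctrace_cbasis: "ctrace f W = (\<Sum>b\<in>cbasis W. csc.representation (cbasis W) (f b) b)"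
  by (simp add: ctrace_def cbasis_def Let_def)

lemma cbasis:
  assumes "findim W"
  shows "cbasis W \<subseteq> W" "csc.independent (cbasis W)" "csc.span (cbasis W) = W" "finite (cbasis W)"
proof -
  have "\<exists>B. B \<subseteq> W \<and> csc.independent B \<and> csc.span B = W"
  proof -
    obtain B where "B \<subseteq> W" "csc.independent B" "W \<subseteq> csc.span B"
      using csc.maximal_independent_subset[of W] by blast
    moreover have "csc.span B \<subseteq> W"
      using \<open>B \<subseteq> W\<close> assms by (intro csc.span_minimal) (auto simp: findim_def)
    ultimately show ?thesis by blast
  qed
  from someI_ex[OF this] show b: "cbasis W \<subseteq> W" "csc.independent (cbasis W)" "csc.span (cbasis W) = W"
    by (auto simp: cbasis_def)
  obtain B where "finite B" "W \<subseteq> csc.span B" using assms by (auto simp: findim_def)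
  then show "finite (cbasis W)"
    using csc.independent_span_bound[of B "cbasis W"] b by auto
qed

lemma clin_add: "clin f \<Longrightarrow> f (x + y) = f x + f y"
  and clin_csc: "clin f \<Longrightarrow> f (a *\<^sub>c x) = a *\<^sub>c f x"
  by (auto simp: clin_def)

lemma clin_0 [simp]: "clin f \<Longrightarrow> f 0 = 0"
  using clin_add[of f 0 0] by simp

lemma clin_minus: "clin f \<Longrightarrow> f (- x) = - f x"
  using clin_add[of f x "- x"] by (simp add: eq_neg_iff_add_eq_0 add.commute)

lemma clin_diff: "clin f \<Longrightarrow> f (x - y) = f x - f y"
  using clin_add[of f x "- y"] by (simp add: clin_minus)

lemma clin_sum: "clin f \<Longrightarrow> f (sum g A) = (\<Sum>i\<in>A. f (g i))"
  by (induction A rule: infinite_finite_induct) (simp_all add: clin_add)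

lemma clin_comp: "clin f \<Longrightarrow> clin g \<Longrightarrow> clin (f \<circ> g)"
  by (simp add: clin_def)

lemma cbasis_expand:
  assumes "findim W" "x \<in> W"
  shows "x = (\<Sum>b\<in>cbasis W. csc.representation (cbasis W) x b *\<^sub>c b)"
  using csc.sum_representation_eq[of "cbasis W" x "cbasis W"] cbasis[OF assms(1)] assms(2) by simp

lemma ctrace_cong:
  assumes "findim W" "\<And>x. x \<in> W \<Longrightarrow> f x = g x"
  shows "ctrace f W = ctrace g W"
  unfolding ctrace_cbasis using assms(2) cbasis(1)[OF assms(1)] by (intro sum.cong) auto

lemma ctrace_add:
  assumes "findim W" "\<And>x. x \<in> W \<Longrightarrow> f x \<in> W" "\<And>x. x \<in> W \<Longrightarrow> g x \<in> W"
  shows "ctrace (\<lambda>x. f x + g x) W = ctrace f W + ctrace g W"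
  unfolding ctrace_cbasis sum.distrib[symmetric]
proof (intro sum.cong refl)
  fix b assume "b \<in> cbasis W"
  then show "csc.representation (cbasis W) (f b + g b) b =
    csc.representation (cbasis W) (f b) b + csc.representation (cbasis W) (g b) b"
    using cbasis[OF assms(1)] assms(2,3) csc.representation_add[of "cbasis W" "g b" "f b"]
    by (auto simp: fun_eq_iff add.commute)
qed

lemma ctrace_scale:
  assumes "findim W" "\<And>x. x \<in> W \<Longrightarrow> f x \<in> W"
  shows "ctrace (\<lambda>x. a *\<^sub>c f x) W = a * ctrace f W"
  unfolding ctrace_cbasis sum_distrib_left
proof (intro sum.cong refl)
  fix b assume "b \<in> cbasis W"
  then show "csc.representation (cbasis W) (a *\<^sub>c f b) b = a * csc.representation (cbasis W) (f b) b"
    using cbasis[OF assms(1)] assms(2) csc.representation_scale[of "cbasis W" "f b" a] by (auto simp: fun_eq_iff)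
qed

lemma ctrace_0 [simp]: "findim W \<Longrightarrow> ctrace (\<lambda>x. 0) W = 0"
  using cbasis(2)[of W] by (simp add: ctrace_cbasis csc.representation_zero)

lemma findim_0: "findim W \<Longrightarrow> 0 \<in> W"
  by (simp add: findim_def csc.subspace_0)

lemma findim_add: "findim W \<Longrightarrow> x \<in> W \<Longrightarrow> y \<in> W \<Longrightarrow> x + y \<in> W"
  by (simp add: findim_def csc.subspace_add)

lemma findim_scale: "findim W \<Longrightarrow> x \<in> W \<Longrightarrow> a *\<^sub>c x \<in> W"
  by (simp add: findim_def csc.subspace_scale)

lemma findim_diff: "findim W \<Longrightarrow> x \<in> W \<Longrightarrow> y \<in> W \<Longrightarrow> x - y \<in> W"
  by (simp add: findim_def csc.subspace_diff)

lemma findim_sum: "findim W \<Longrightarrow> (\<And>i. i \<in> A \<Longrightarrow> f i \<in> W) \<Longrightarrow> sum f A \<in> W"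
  by (simp add: findim_def csc.subspace_sum)

lemma ctrace_sum:
  assumes "findim W" "finite A" "\<And>i x. i \<in> A \<Longrightarrow> x \<in> W \<Longrightarrow> f i x \<in> W"
  shows "ctrace (\<lambda>x. \<Sum>i\<in>A. a i *\<^sub>c f i x) W = (\<Sum>i\<in>A. a i * ctrace (f i) W)"
  using assms(2,3)
proof (induction A rule: finite_induct)
  case (insert i A)
  have "ctrace (\<lambda>x. a i *\<^sub>c f i x + (\<Sum>i\<in>A. a i *\<^sub>c f i x)) W =
     ctrace (\<lambda>x. a i *\<^sub>c f i x) W + ctrace (\<lambda>x. \<Sum>i\<in>A. a i *\<^sub>c f i x) W"
    using insert.prems by (intro ctrace_add assms(1) findim_scale findim_sum) auto
  then show ?case using insert assms(1) by (simp add: ctrace_scale)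
qed (simp add: assms(1))

text \<open>The trace of a product of two rectangular matrices. The double sum is symmetric in the
  two factors up to the order of summation, whence cyclicity.\<close>

lemma ctrace_comp_expand:
  assumes "findim W1" "findim W2" "clin g" "\<And>x. x \<in> W1 \<Longrightarrow> f x \<in> W2" "\<And>x. x \<in> W2 \<Longrightarrow> g x \<in> W1"
  shows "ctrace (g \<circ> f) W1 = (\<Sum>b\<in>cbasis W1. \<Sum>d\<in>cbasis W2.
     csc.representation (cbasis W2) (f b) d * csc.representation (cbasis W1) (g d) b)"
  unfolding ctrace_cbasis
proof (intro sum.cong refl)
  fix b assume "b \<in> cbasis W1"
  then have fb: "f b \<in> W2" using cbasis(1)[OF assms(1)] assms(4) by blast
  have "(g \<circ> f) b = g (\<Sum>d\<in>cbasis W2. csc.representation (cbasis W2) (f b) d *\<^sub>c d)"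
    using cbasis_expand[OF assms(2) fb] by simp
  also have "\<dots> = (\<Sum>d\<in>cbasis W2. csc.representation (cbasis W2) (f b) d *\<^sub>c g d)"
    by (simp add: clin_sum clin_csc assms(3))
  also have "csc.representation (cbasis W1) \<dots> b = (\<Sum>d\<in>cbasis W2.
     csc.representation (cbasis W2) (f b) d * csc.representation (cbasis W1) (g d) b)"
  proof -
    have gd: "g d \<in> csc.span (cbasis W1)" if "d \<in> cbasis W2" for d
      using that cbasis(1)[OF assms(2)] cbasis(3)[OF assms(1)] assms(5) by auto
    have "csc.representation (cbasis W1) (\<Sum>d\<in>cbasis W2. csc.representation (cbasis W2) (f b) d *\<^sub>c g d)
      = (\<lambda>b'. \<Sum>d\<in>cbasis W2. csc.representation (cbasis W1) (csc.representation (cbasis W2) (f b) d *\<^sub>c g d) b')"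
      using gd cbasis(2)[OF assms(1)] by (intro csc.representation_sum) (auto intro: csc.span_scale)
    then have "csc.representation (cbasis W1) (\<Sum>d\<in>cbasis W2. csc.representation (cbasis W2) (f b) d *\<^sub>c g d) b
      = (\<Sum>d\<in>cbasis W2. csc.representation (cbasis W1) (csc.representation (cbasis W2) (f b) d *\<^sub>c g d) b)"
      by simp
    also have "\<dots> = (\<Sum>d\<in>cbasis W2. csc.representation (cbasis W2) (f b) d * csc.representation (cbasis W1) (g d) b)"
      using gd cbasis(2)[OF assms(1)] by (intro sum.cong refl) (simp add: csc.representation_scale)
    finally show ?thesis .
  qed
  finally show "csc.representation (cbasis W1) ((g \<circ> f) b) b = (\<Sum>d\<in>cbasis W2.
     csc.representation (cbasis W2) (f b) d * csc.representation (cbasis W1) (g d) b)" .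
qed

lemma ctrace_cyclic:
  assumes "findim W1" "findim W2" "clin f" "clin g" "\<And>x. x \<in> W1 \<Longrightarrow> f x \<in> W2" "\<And>x. x \<in> W2 \<Longrightarrow> g x \<in> W1"
  shows "ctrace (g \<circ> f) W1 = ctrace (f \<circ> g) W2"
proof -
  have "ctrace (g \<circ> f) W1 = (\<Sum>b\<in>cbasis W1. \<Sum>d\<in>cbasis W2.
     csc.representation (cbasis W2) (f b) d * csc.representation (cbasis W1) (g d) b)"
    by (rule ctrace_comp_expand) fact+
  also have "\<dots> = (\<Sum>d\<in>cbasis W2. \<Sum>b\<in>cbasis W1.
     csc.representation (cbasis W1) (g d) b * csc.representation (cbasis W2) (f b) d)"
    by (subst sum.swap) (simp add: mult.commute)
  also have "\<dots> = ctrace (f \<circ> g) W2"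
    by (rule ctrace_comp_expand[symmetric]) fact+
  finally show ?thesis .
qed

text \<open>Write f = f p1 + f p2 with the projections and move each projection around the trace,
  which restricts \<open>f\<close> to the summand.\<close>

lemma ctrace_direct_sum:
  assumes W: "findim W" "findim W1" "findim W2" and f: "clin f" and p: "clin p1" "clin p2"
    and sub: "W1 \<subseteq> W" "W2 \<subseteq> W" and f_W: "\<And>x. x \<in> W \<Longrightarrow> f x \<in> W"
    and f1: "\<And>x. x \<in> W1 \<Longrightarrow> f x \<in> W1" and f2: "\<And>x. x \<in> W2 \<Longrightarrow> f x \<in> W2"
    and p1: "\<And>x. x \<in> W \<Longrightarrow> p1 x \<in> W1" "\<And>x. x \<in> W1 \<Longrightarrow> p1 x = x"
    and p2: "\<And>x. x \<in> W \<Longrightarrow> p2 x \<in> W2" "\<And>x. x \<in> W2 \<Longrightarrow> p2 x = x"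
    and sum: "\<And>x. x \<in> W \<Longrightarrow> p1 x + p2 x = x"
  shows "ctrace f W = ctrace f W1 + ctrace f W2"
proof -
  have part: "ctrace (f \<circ> p) W = ctrace f U"
    if "findim U" "clin p" "U \<subseteq> W" "\<And>x. x \<in> U \<Longrightarrow> f x \<in> U" "\<And>x. x \<in> W \<Longrightarrow> p x \<in> U" "\<And>x. x \<in> U \<Longrightarrow> p x = x" for p U
  proof -
    \<comment> \<open>Here \<open>id\<close> is the inclusion of \<open>U\<close> into
      \<open>W\<close>, and \<open>f \<circ> p\<close> is regarded as a map from \<open>W\<close> to
      \<open>U\<close>.\<close>
    have "ctrace (id \<circ> (f \<circ> p)) W = ctrace ((f \<circ> p) \<circ> id) U"
      using that W(1) f by (intro ctrace_cyclic clin_comp) (auto simp: clin_def)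
    also have "\<dots> = ctrace f U" using that by (intro ctrace_cong) auto
    finally show ?thesis by simp
  qed
  have "ctrace f W = ctrace (\<lambda>x. (f \<circ> p1) x + (f \<circ> p2) x) W"
    using sum by (intro ctrace_cong W(1)) (simp flip: clin_add[OF f])
  also have "\<dots> = ctrace (f \<circ> p1) W + ctrace (f \<circ> p2) W"
    using p1(1) p2(1) f1 f2 sub by (intro ctrace_add W(1)) auto
  also have "\<dots> = ctrace f W1 + ctrace f W2"
    using part[of W1 p1] part[of W2 p2] W p sub f1 f2 p1 p2 by simp
  finally show ?thesis .
qed

lemma ctrace_diff:
  assumes "findim W" "\<And>x. x \<in> W \<Longrightarrow> f x \<in> W" "\<And>x. x \<in> W \<Longrightarrow> g x \<in> W"
  shows "ctrace (\<lambda>x. f x - g x) W = ctrace f W - ctrace g W"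
  using ctrace_add[of W "\<lambda>x. f x - g x" g] assms by (simp add: findim_diff)

lemma findim_trivial: "findim {0}"
  unfolding findim_def by (auto intro!: exI[of _ "{}"] simp: csc.subspace_def)

lemma ctrace_trivial [simp]: "ctrace f {0} = 0"
proof -
  have "cbasis ({0} :: 'a set) = {}"
    using cbasis(1,2)[OF findim_trivial] csc.dependent_zero by blast
  then show ?thesis by (simp add: ctrace_cbasis)
qed

lemma findim_Int: "findim W \<Longrightarrow> csc.subspace U \<Longrightarrow> findim (U \<inter> W)"
  unfolding findim_def by (auto intro: csc.subspace_inter)

section \<open>Modes in a vertex operator algebra\<close>

lemma fsum_eq_sum:
  assumes "finite A" "\<And>i. i \<notin> A \<Longrightarrow> f i = 0"
  shows "fsum f = sum f A"
  unfolding fsum_def using assms by (intro sum.mono_neutral_left) auto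

locale voa =
  fixes Y :: "'v::cvector \<Rightarrow> int \<Rightarrow> 'v \<Rightarrow> 'v" and vac om :: 'v and c :: complex
  assumes is_voa: "is_voa Y vac om c"
begin

abbreviation V :: "int \<Rightarrow> 'v set" where "V \<equiv> wtsp Y om"

lemma
  shows clin_Y: "clin (Y a n)"
    and clin_Y_left: "clin (\<lambda>a. Y a n b)"
    and Y_trunc: "\<exists>N. \<forall>n\<ge>N. Y a n b = 0"
    and borcherds: "fsum (\<lambda>i::nat. (of_int p gchoose i) *\<^sub>c Y (Y a (r + int i) b) (p + q - int i) x) =
        fsum (\<lambda>i::nat. ((-1) ^ i * (of_int r gchoose i)) *\<^sub>c
                (Y a (p + r - int i) (Y b (q + int i) x)
                 - ((-1::complex) powi r) *\<^sub>c Y b (q + r - int i) (Y a (p + int i) x)))"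
    and Y_derivative: "Y (Lop Y om (-1) a) n x = (- of_int n) *\<^sub>c Y a (n - 1) x"
    and decomposition: "\<exists>f :: int \<Rightarrow> 'v. finite {w. f w \<noteq> 0} \<and> (\<forall>w. f w \<in> V w) \<and> v = sum f {w. f w \<noteq> 0}"
    and V_finite: "\<exists>B. finite B \<and> csc.span B = V w"
    and V_bounded: "\<exists>N. \<forall>w<N. V w = {0}"
proof -
  note h = is_voa[unfolded is_voa_def]
  show "clin (Y a n)"
    by (rule h[THEN conjunct1, rule_format])
  show "clin (\<lambda>a. Y a n b)"
    by (rule h[THEN conjunct2, THEN conjunct1, rule_format])
  show "\<exists>N. \<forall>n\<ge>N. Y a n b = 0"
    by (rule h[THEN conjunct2, THEN conjunct2, THEN conjunct1, rule_format])
  show "fsum (\<lambda>i::nat. (of_int p gchoose i) *\<^sub>c Y (Y a (r + int i) b) (p + q - int i) x) =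
        fsum (\<lambda>i::nat. ((-1) ^ i * (of_int r gchoose i)) *\<^sub>c
                (Y a (p + r - int i) (Y b (q + int i) x)
                 - ((-1::complex) powi r) *\<^sub>c Y b (q + r - int i) (Y a (p + int i) x)))"
    by (rule h[THEN conjunct2, THEN conjunct2, THEN conjunct2, THEN conjunct2, THEN conjunct2, THEN conjunct2, THEN conjunct1, rule_format])
  show "Y (Lop Y om (-1) a) n x = (- of_int n) *\<^sub>c Y a (n - 1) x"
    by (rule h[THEN conjunct2, THEN conjunct2, THEN conjunct2, THEN conjunct2, THEN conjunct2, THEN conjunct2, THEN conjunct2, THEN conjunct2, THEN conjunct1, rule_format])
  show "\<exists>f :: int \<Rightarrow> 'v. finite {w. f w \<noteq> 0} \<and> (\<forall>w. f w \<in> V w) \<and> v = sum f {w. f w \<noteq> 0}"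
    by (rule h[THEN conjunct2, THEN conjunct2, THEN conjunct2, THEN conjunct2, THEN conjunct2, THEN conjunct2, THEN conjunct2, THEN conjunct2, THEN conjunct2, THEN conjunct1, rule_format])
  show "\<exists>B. finite B \<and> csc.span B = V w"
    by (rule h[THEN conjunct2, THEN conjunct2, THEN conjunct2, THEN conjunct2, THEN conjunct2, THEN conjunct2, THEN conjunct2, THEN conjunct2, THEN conjunct2, THEN conjunct2, THEN conjunct1, rule_format])
  show "\<exists>N. \<forall>w<N. V w = {0}"
    by (rule h[THEN conjunct2, THEN conjunct2, THEN conjunct2, THEN conjunct2, THEN conjunct2, THEN conjunct2, THEN conjunct2, THEN conjunct2, THEN conjunct2, THEN conjunct2, THEN conjunct2, rule_format])
qed

section \<open>Weight spaces and weight components\<close>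

lemma findim_V: "findim (V w)"
proof -
  obtain B where "finite B" "csc.span B = V w" using V_finite by blast
  then show ?thesis unfolding findim_def using csc.subspace_span[of B] by auto
qed

lemma Y_0 [simp]: "Y a n 0 = 0" "Y 0 n b = 0"
  using clin_0[OF clin_Y] clin_0[OF clin_Y_left] by auto

text \<open>The Borcherds identity for \<open>om\<close> with p = 1 and r = 0 has the terms i = 0, 1
  on the left and i = 0 on the right; the derivative property evaluates the mode of L(-1)b.\<close>

lemma L0_commutator:
  "Y om 1 (Y b k x) - Y b k (Y om 1 x) = Y (Y om 1 b) k x - of_int (k + 1) *\<^sub>c Y b k x"
proof -
  have "fsum (\<lambda>i::nat. (of_int 1 gchoose i) *\<^sub>c Y (Y om (0 + int i) b) (1 + k - int i) x)
     = (\<Sum>i\<in>{0,1}. (of_int 1 gchoose i) *\<^sub>c Y (Y om (0 + int i) b) (1 + k - int i) x)"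
  proof (rule fsum_eq_sum)
    fix i :: nat assume "i \<notin> {0,1}"
    then have "(of_int 1 gchoose i :: complex) = of_nat (1 choose i)" by (simp add: binomial_gbinomial)
    also have "1 choose i = 0" using \<open>i \<notin> {0,1}\<close> by (intro binomial_eq_0) auto
    finally show "(of_int 1 gchoose i) *\<^sub>c Y (Y om (0 + int i) b) (1 + k - int i) x = 0" by simp
  qed simp
  moreover have "fsum (\<lambda>i::nat. ((-1) ^ i * (of_int 0 gchoose i)) *\<^sub>c
                (Y om (1 + 0 - int i) (Y b (k + int i) x)
                 - ((-1::complex) powi 0) *\<^sub>c Y b (k + 0 - int i) (Y om (1 + int i) x)))
     = (\<Sum>i\<in>{0}. ((-1) ^ i * (of_int 0 gchoose i)) *\<^sub>c
                (Y om (1 + 0 - int i) (Y b (k + int i) x)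
                 - ((-1::complex) powi 0) *\<^sub>c Y b (k + 0 - int i) (Y om (1 + int i) x)))"
    by (rule fsum_eq_sum) (auto simp: gr0_conv_Suc)
  moreover have "Y (Y om 0 b) (k + 1) x = - (of_int (k + 1) *\<^sub>c Y b k x)"
    using Y_derivative[of b "k + 1" x] by (simp only: Lop_def csc.scale_minus_left) simp
  ultimately have "- (of_int (k + 1) *\<^sub>c Y b k x) + Y (Y om 1 b) k x = Y om 1 (Y b k x) - Y b k (Y om 1 x)"
    using borcherds[of 1 om 0 b k x] by (simp add: csc_one add.commute del: of_int_add)
  then show ?thesis by (metis add_uminus_conv_diff add.commute)
qed

lemma Y_weight:
  assumes "b \<in> V w" "x \<in> V N"
  shows "Y b k x \<in> V (N + w - k - 1)"
proof -
  have "Y om 1 (Y b k x) = Y b k (Y om 1 x) + (Y (Y om 1 b) k x - of_int (k + 1) *\<^sub>c Y b k x)"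
    using L0_commutator[of b k x] by (simp add: algebra_simps)
  moreover have "Y om 1 x = of_int N *\<^sub>c x" "Y om 1 b = of_int w *\<^sub>c b"
    using assms by (auto simp: wtsp_def Lop_def)
  ultimately have "Y om 1 (Y b k x) = of_int N *\<^sub>c Y b k x + (of_int w *\<^sub>c Y b k x - of_int (k + 1) *\<^sub>c Y b k x)"
    by (simp add: clin_csc[OF clin_Y] clin_csc[OF clin_Y_left])
  then show ?thesis
    by (simp add: wtsp_def Lop_def csc.scale_left_distrib csc.scale_left_diff_distrib algebra_simps)
qed

text \<open>Applying L(0) - w0 to the relation removes the summand of weight \<open>w0\<close> and
  multiplies the others by nonzero scalars.\<close>

lemma V_independent:
  assumes "finite S" "\<And>w. w \<in> S \<Longrightarrow> f w \<in> V w" "sum f S = 0" "w \<in> S"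
  shows "f w = 0"
  using assms
proof (induction S arbitrary: f w rule: finite_induct)
  case (insert w0 S)
  have L: "Y om 1 (f w) = of_int w *\<^sub>c f w" if "w \<in> insert w0 S" for w
    using insert.prems(1)[OF that] by (simp add: wtsp_def Lop_def)
  have "0 = Y om 1 (sum f (insert w0 S)) - of_int w0 *\<^sub>c sum f (insert w0 S)"
    using insert.prems(2) by simp
  also have "\<dots> = (\<Sum>w\<in>insert w0 S. of_int w *\<^sub>c f w) - (\<Sum>w\<in>insert w0 S. of_int w0 *\<^sub>c f w)"
    using L by (simp only: clin_sum[OF clin_Y] csc.scale_sum_right cong: sum.cong)
  also have "\<dots> = (\<Sum>w\<in>S. of_int (w - w0) *\<^sub>c f w)"
    using insert.hyps by (simp add: csc.scale_left_diff_distrib sum_subtractf)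
  finally have "(\<Sum>w\<in>S. of_int (w - w0) *\<^sub>c f w) = 0" by simp
  then have "of_int (w - w0) *\<^sub>c f w = 0" if "w \<in> S" for w
    using insert.IH[of "\<lambda>w. of_int (w - w0) *\<^sub>c f w" w] insert.prems(1) that
    by (auto intro: findim_scale findim_V)
  then have S: "f w = 0" if "w \<in> S" for w
    using that insert.hyps(2) by (auto simp del: of_int_diff)
  moreover have "f w0 = 0" using insert.prems(2) insert.hyps S by simp
  ultimately show ?case using insert.prems(3) by auto
qed simp

text \<open>Independence of the weight spaces gives uniqueness of the decomposition, which the
  definite description in \<open>wcomp\<close> needs.\<close>

lemma wcomp_eqI:
  assumes "finite S" "\<And>w. w \<in> S \<Longrightarrow> f w \<in> V w"
  shows "wcomp Y om (sum f S) = (\<lambda>w. if w \<in> S then f w else 0)"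
  unfolding wcomp_def
proof (rule the_equality)
  let ?g = "\<lambda>w. if w \<in> S then f w else 0"
  have g0: "0 \<in> V w" for w using findim_0[OF findim_V] .
  have sub: "{w. ?g w \<noteq> 0} \<subseteq> S" by auto
  have "sum ?g {w. ?g w \<noteq> 0} = sum ?g S"
    using assms(1) by (intro sum.mono_neutral_left) auto
  then show "finite {w. ?g w \<noteq> 0} \<and> (\<forall>w. ?g w \<in> V w) \<and> sum f S = sum ?g {w. ?g w \<noteq> 0}"
    using assms g0 finite_subset[OF sub] by auto
  fix h assume h: "finite {w. h w \<noteq> 0} \<and> (\<forall>w. h w \<in> V w) \<and> sum f S = sum h {w. h w \<noteq> 0}"
  let ?T = "S \<union> {w. h w \<noteq> 0}"
  have "sum ?g ?T = sum ?g S" using assms(1) h by (intro sum.mono_neutral_right) auto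
  moreover have "sum h ?T = sum h {w. h w \<noteq> 0}" using assms(1) h by (intro sum.mono_neutral_right) auto
  ultimately have s0: "(\<Sum>w\<in>?T. h w - ?g w) = 0" using h by (simp add: sum_subtractf)
  have hg: "h w - ?g w \<in> V w" for w
    using assms(2)[of w] h g0[of w] by (intro findim_diff findim_V) auto
  have "h w - ?g w = 0" if "w \<in> ?T" for w
    by (rule V_independent[where f = "\<lambda>w. h w - ?g w", OF _ hg s0 that]) (use assms(1) h in blast)
  then have "h w = ?g w" if "w \<in> ?T" for w using that by (simp only: right_minus_eq)
  moreover have "h w = ?g w" if "w \<notin> ?T" for w using that by simp
  ultimately show "h = ?g" by (intro ext) blast
qed

lemma wcomp:
  shows finite_wcomp: "finite {w. wcomp Y om v w \<noteq> 0}"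
    and wcomp_in_V: "wcomp Y om v w \<in> V w"
    and sum_wcomp: "(\<Sum>w | wcomp Y om v w \<noteq> 0. wcomp Y om v w) = v"
proof -
  obtain f where f: "finite {w. f w \<noteq> 0}" "\<And>w. f w \<in> V w" "v = sum f {w. f w \<noteq> 0}"
    using decomposition[of v] by blast
  have "wcomp Y om v = f"
    unfolding f(3) using wcomp_eqI[of "{w. f w \<noteq> 0}" f] f by (auto simp: fun_eq_iff)
  then show "finite {w. wcomp Y om v w \<noteq> 0}" "wcomp Y om v w \<in> V w"
    "(\<Sum>w | wcomp Y om v w \<noteq> 0. wcomp Y om v w) = v" using f by auto
qed

text \<open>The linear extension to all of V of a family of linear maps \<open>\<phi> w\<close> on
  the weight spaces.\<close>

definition wsum :: "(int \<Rightarrow> 'v \<Rightarrow> 'v) \<Rightarrow> 'v \<Rightarrow> 'v" where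
  "wsum \<phi> v = (\<Sum>w | wcomp Y om v w \<noteq> 0. \<phi> w (wcomp Y om v w))"

lemma wsum_sum:
  assumes "finite S" "\<And>w. w \<in> S \<Longrightarrow> f w \<in> V w" "\<And>w. \<phi> w 0 = 0"
  shows "wsum \<phi> (sum f S) = (\<Sum>w\<in>S. \<phi> w (f w))"
proof -
  have "wcomp Y om (sum f S) = (\<lambda>w. if w \<in> S then f w else 0)"
    using wcomp_eqI[of S f] assms by blast
  then show ?thesis
    unfolding wsum_def using assms by (auto intro!: sum.mono_neutral_cong_left)
qed

lemma wsum_superset:
  assumes "finite S" "{w. wcomp Y om v w \<noteq> 0} \<subseteq> S" "\<And>w. \<phi> w 0 = 0"
  shows "wsum \<phi> v = (\<Sum>w\<in>S. \<phi> w (wcomp Y om v w))"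
  unfolding wsum_def using assms by (intro sum.mono_neutral_left) auto

lemma wsum_homogeneous:
  assumes "a \<in> V w" "\<And>w. \<phi> w 0 = 0"
  shows "wsum \<phi> a = \<phi> w a"
  using wsum_sum[of "{w}" "\<lambda>_. a" \<phi>] assms by auto

lemma clin_wsum:
  assumes "\<And>w. clin (\<phi> w)"
  shows "clin (wsum \<phi>)"
  unfolding clin_def
proof (intro conjI allI)
  have p0: "\<phi> w 0 = 0" for w using assms by simp
  show "wsum \<phi> (x + y) = wsum \<phi> x + wsum \<phi> y" for x y
  proof -
    let ?S = "{w. wcomp Y om x w \<noteq> 0} \<union> {w. wcomp Y om y w \<noteq> 0}"
    have S: "finite ?S" using finite_wcomp by simp
    have "x = (\<Sum>w\<in>?S. wcomp Y om x w)" "y = (\<Sum>w\<in>?S. wcomp Y om y w)"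
      using S wsum_superset[of ?S x "\<lambda>w a. a"] wsum_superset[of ?S y "\<lambda>w a. a"] sum_wcomp
      by (auto simp: wsum_def)
    then have "x + y = (\<Sum>w\<in>?S. wcomp Y om x w + wcomp Y om y w)" by (simp add: sum.distrib)
    then have "wsum \<phi> (x + y) = (\<Sum>w\<in>?S. \<phi> w (wcomp Y om x w + wcomp Y om y w))"
      using wsum_sum[of ?S "\<lambda>w. wcomp Y om x w + wcomp Y om y w" \<phi>] S p0
      by (simp add: wcomp_in_V findim_add[OF findim_V])
    also have "\<dots> = wsum \<phi> x + wsum \<phi> y"
      using wsum_superset[of ?S x \<phi>] wsum_superset[of ?S y \<phi>] S p0
      by (simp add: clin_add[OF assms] sum.distrib)
    finally show ?thesis .
  qed
  show "wsum \<phi> (a *\<^sub>c x) = a *\<^sub>c wsum \<phi> x" for a x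
  proof -
    let ?S = "{w. wcomp Y om x w \<noteq> 0}"
    have "a *\<^sub>c x = (\<Sum>w\<in>?S. a *\<^sub>c wcomp Y om x w)"
      by (simp add: sum_wcomp flip: csc.scale_sum_right)
    then have "wsum \<phi> (a *\<^sub>c x) = (\<Sum>w\<in>?S. \<phi> w (a *\<^sub>c wcomp Y om x w))"
      using wsum_sum[of ?S "\<lambda>w. a *\<^sub>c wcomp Y om x w" \<phi>] finite_wcomp p0
      by (simp add: wcomp_in_V findim_scale[OF findim_V])
    then show ?thesis
      by (simp add: clin_csc[OF assms] csc.scale_sum_right wsum_def)
  qed
qed

text \<open>The index is normalised so that \<open>mode u j\<close> lowers weights by
  \<open>j\<close>, whatever the weights of the components of \<open>u\<close>; \<open>j = 0\<close>
  is the zero mode.\<close>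

definition mode :: "'v \<Rightarrow> int \<Rightarrow> 'v \<Rightarrow> 'v" where
  "mode u j x = wsum (\<lambda>w a. Y a (w - 1 + j) x) u"

lemma zmode_eq_mode: "zmode Y om v = mode v 0"
  by (simp add: fun_eq_iff zmode_def mode_def wsum_def)

lemma clin_mode_left: "clin (\<lambda>a. mode a j x)"
  unfolding mode_def using clin_wsum[OF clin_Y_left] .

lemma clin_mode: "clin (mode u j)"
  unfolding mode_def wsum_def clin_def
  by (simp add: clin_add[OF clin_Y] clin_csc[OF clin_Y] sum.distrib csc.scale_sum_right)

lemma mode_homogeneous: "a \<in> V w \<Longrightarrow> mode a j x = Y a (w - 1 + j) x"
  unfolding mode_def by (rule wsum_homogeneous) auto

lemma mode_weight:
  assumes "x \<in> V N"
  shows "mode u j x \<in> V (N - j)"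
  unfolding mode_def wsum_def
proof (rule findim_sum[OF findim_V])
  fix w show "Y (wcomp Y om u w) (w - 1 + j) x \<in> V (N - j)"
    using Y_weight[OF wcomp_in_V assms, of u w "w - 1 + j"] by (simp add: algebra_simps)
qed

section \<open>Uniform truncation bounds and square bracket modes\<close>

lemma modes_bounded_at:
  obtains M :: nat where "\<And>w k. k \<ge> int M \<Longrightarrow> Y (wcomp Y om u w) k v = 0"
proof -
  let ?S = "{w. wcomp Y om u w \<noteq> 0}"
  have "\<forall>w. \<exists>N. \<forall>k\<ge>N. Y (wcomp Y om u w) k v = 0" using Y_trunc by blast
  then obtain N where N: "\<And>w k. k \<ge> N w \<Longrightarrow> Y (wcomp Y om u w) k v = 0" by metis
  \<comment> \<open>Inserting 0 keeps the maximum defined when \<open>u\<close> has no nonzero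
    component.\<close>
  let ?M = "nat (Max (insert 0 (N ` ?S)))"
  have "Y (wcomp Y om u w) k v = 0" if k: "k \<ge> int ?M" for w k
  proof (cases "w \<in> ?S")
    case True
    have "N w \<le> Max (insert 0 (N ` ?S))" using True finite_wcomp by (intro Max_ge) auto
    also have "\<dots> \<le> int ?M" by (simp only: of_nat_nat nat_le_0 int_nat_eq split: if_split) simp
    also note k
    finally show ?thesis by (rule N)
  qed simp
  then show ?thesis using that[of ?M] by blast
qed

lemma modes_bounded:
  obtains M :: nat where "\<And>w w' k. k \<ge> int M \<Longrightarrow> Y (wcomp Y om u w) k (wcomp Y om v w') = 0"
proof -
  let ?S = "{w. wcomp Y om v w \<noteq> 0}"
  have "\<forall>w'. \<exists>M::nat. \<forall>w. \<forall>k\<ge>int M. Y (wcomp Y om u w) k (wcomp Y om v w') = 0"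
    using modes_bounded_at by metis
  then obtain N :: "int \<Rightarrow> nat" where N: "\<And>w w' k. k \<ge> int (N w') \<Longrightarrow> Y (wcomp Y om u w) k (wcomp Y om v w') = 0"
    by metis
  let ?M = "Max (insert 0 (N ` ?S))"
  have "Y (wcomp Y om u w) k (wcomp Y om v w') = 0" if k: "k \<ge> int ?M" for w w' k
  proof (cases "w' \<in> ?S")
    case True
    then have "N w' \<le> ?M" using finite_wcomp by (intro Max_ge) auto
    then have "int (N w') \<le> k" using k by linarith
    then show ?thesis by (rule N)
  qed simp
  then show ?thesis using that[of ?M] by blast
qed

text \<open>The sum over modes is cut off below by the vanishing of \<open>sqcoef\<close> for
  \<open>k < m\<close>, and above by the bound on the modes.\<close>

lemma sqmode_eq:
  assumes "\<And>w k. k \<ge> int M \<Longrightarrow> Y (wcomp Y om u w) k v = 0"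
  shows "sqmode Y om u m v =
    (\<Sum>w | wcomp Y om u w \<noteq> 0. \<Sum>k\<in>{m..<int M}. sqcoef w k m *\<^sub>c Y (wcomp Y om u w) k v)"
  unfolding sqmode_def
proof (intro sum.cong refl fsum_eq_sum)
  fix w k assume "k \<notin> {m..<int M}"
  then show "sqcoef w k m *\<^sub>c Y (wcomp Y om u w) k v = 0"
    using assms[of k w] by (cases "k < m") (auto simp: sqcoef_eq_0)
qed simp

text \<open>\<open>jmode M u v s r\<close> is the coefficient \<open>Res (1 + x)\<^sup>w\<^sup>-\<^sup>1\<^sup>+\<^sup>s x\<^sup>r Y(u, x)v\<close> for \<open>u\<close> of weight \<open>w\<close>;
  \<open>M\<close> bounds the modes of \<open>u\<close> that do not annihilate \<open>v\<close>.\<close>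
definition jmode :: "nat \<Rightarrow> 'v \<Rightarrow> 'v \<Rightarrow> int \<Rightarrow> int \<Rightarrow> 'v" where
  "jmode M u v s r = (\<Sum>w | wcomp Y om u w \<noteq> 0. \<Sum>k\<in>{r..<int M}.
     (of_int (w - 1 + s) gchoose nat (k - r)) *\<^sub>c Y (wcomp Y om u w) k v)"

lemma sum_int_triangle:
  fixes f :: "int \<Rightarrow> int \<Rightarrow> 'a::comm_monoid_add"
  shows "(\<Sum>r\<in>{m..<M}. \<Sum>k\<in>{r..<M}. f r k) = (\<Sum>k\<in>{m..<M}. \<Sum>r\<in>{m..k}. f r k)"
  unfolding sum.Sigma[OF finite_atLeastLessThan_int ballI[OF finite_atLeastLessThan_int]]
    sum.Sigma[OF finite_atLeastLessThan_int ballI[OF finite_atLeastAtMost_int]]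
  by (rule sum.reindex_bij_witness[where i = "\<lambda>(a, b). (b, a)" and j = "\<lambda>(a, b). (b, a)"]) auto

lemma sqmode_eq_jmode:
  assumes "\<And>w k. k \<ge> int M \<Longrightarrow> Y (wcomp Y om u w) k v = 0"
  shows "sqmode Y om u m v = (\<Sum>r\<in>{m..<int M}. sqcoef 1 r m *\<^sub>c jmode M u v 0 r)"
proof -
  have "(\<Sum>r\<in>{m..<int M}. sqcoef 1 r m *\<^sub>c jmode M u v 0 r) =
     (\<Sum>w | wcomp Y om u w \<noteq> 0. \<Sum>r\<in>{m..<int M}. \<Sum>k\<in>{r..<int M}.
       (sqcoef 1 r m * (of_int (w - 1) gchoose nat (k - r))) *\<^sub>c Y (wcomp Y om u w) k v)"
    unfolding jmode_def csc.scale_sum_right by (subst sum.swap) simp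
  also have "\<dots> = (\<Sum>w | wcomp Y om u w \<noteq> 0. \<Sum>k\<in>{m..<int M}. sqcoef w k m *\<^sub>c Y (wcomp Y om u w) k v)"
    unfolding sum_int_triangle
    by (intro sum.cong refl) (simp add: sqcoef_expand[of m] flip: csc.scale_sum_left)
  finally show ?thesis by (simp add: sqmode_eq[OF assms])
qed

text \<open>By \<open>sum_sqcoef_powers\<close>, the exponential sum of the u[m]v collects into the
  element whose zero mode is the commutator of u_s and v_(-s).\<close>

lemma sum_sqmode_eq_jmode:
  assumes "\<And>w k. k \<ge> int M \<Longrightarrow> Y (wcomp Y om u w) k v = 0"
  shows "(\<Sum>m<M. (of_int s ^ m / fact m) *\<^sub>c sqmode Y om u (int m) v) = jmode M u v s 0"
proof -
  have sq: "sqmode Y om u m v =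
    (\<Sum>w | wcomp Y om u w \<noteq> 0. \<Sum>k\<in>{m..<int M}. sqcoef w k m *\<^sub>c Y (wcomp Y om u w) k v)" for m
    using sqmode_eq assms by blast
  have conv: "(\<Sum>k\<in>{int a..<int b}. f k) = (\<Sum>k\<in>{a..<b}. f (int k))" for f :: "int \<Rightarrow> 'v" and a b
    by (rule sum.reindex_bij_witness[where i = int and j = nat]) auto
  have tri: "(\<Sum>m<M. \<Sum>k\<in>{m..<M}. f m k) = (\<Sum>k<M. \<Sum>m\<le>k. f m k)" for f :: "nat \<Rightarrow> nat \<Rightarrow> 'v"
    unfolding sum.Sigma[OF finite_lessThan ballI[OF finite_atLeastLessThan]]
      sum.Sigma[OF finite_lessThan ballI[OF finite_atMost]]
    by (rule sum.reindex_bij_witness[where i = "\<lambda>(a, b). (b, a)" and j = "\<lambda>(a, b). (b, a)"]) auto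
  have "(\<Sum>m<M. (of_int s ^ m / fact m) *\<^sub>c sqmode Y om u (int m) v) =
    (\<Sum>w | wcomp Y om u w \<noteq> 0. \<Sum>m<M. \<Sum>k\<in>{m..<M}.
       (of_int s ^ m / fact m * sqcoef w (int k) (int m)) *\<^sub>c Y (wcomp Y om u w) (int k) v)"
    unfolding sq csc.scale_sum_right conv by (subst sum.swap) simp
  also have "\<dots> = (\<Sum>w | wcomp Y om u w \<noteq> 0. \<Sum>k<M.
       (of_int (w - 1 + s) gchoose k) *\<^sub>c Y (wcomp Y om u w) (int k) v)"
    unfolding tri by (intro sum.cong refl) (simp only: sum_sqcoef_powers flip: csc.scale_sum_left)
  finally show ?thesis
    using conv[of _ 0 M] by (simp add: jmode_def atLeast0LessThan)
qed

section \<open>Zero modes through the Borcherds identity\<close>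

lemma V_lower: obtains N0 where "\<And>w. w < N0 \<Longrightarrow> V w = {0}"
  using V_bounded by blast

text \<open>The left side is one side of the Borcherds identity. On the other side, the two bounds
  on \<open>I\<close> ensure that for i >= \<open>I\<close> both inner modes map \<open>x\<close>
  into weights below \<open>N0\<close>, hence to 0.\<close>

lemma zmode_jmode_homogeneous:
  assumes a: "a \<in> V w" and b: "b \<in> V w'" and x: "x \<in> V N"
    and N0: "\<And>w. w < N0 \<Longrightarrow> V w = {0}"
    and M: "\<And>k. k \<ge> int M \<Longrightarrow> Y a k b = 0"
    and I: "int I > N + r + s - N0" "int I > N - s - N0"
  shows "zmode Y om (\<Sum>k\<in>{r..<int M}. (of_int (w - 1 + s) gchoose nat (k - r)) *\<^sub>c Y a k b) x =
    (\<Sum>i<I. ((-1) ^ i * (of_int r gchoose i)) *\<^sub>c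
      (mode a (s + r - int i) (mode b (int i - r - s) x)
       - ((-1) powi r) *\<^sub>c mode b (- int i - s) (mode a (int i + s) x)))"
proof -
  \<comment> \<open>With these values p + q - i is one less than the weight of a(r+i)b, so every
    outer mode on the left is a zero mode.\<close>
  define p q where "p = w - 1 + s" and "q = w' - 1 - r - s"
  have "zmode Y om (\<Sum>k\<in>{r..<int M}. (of_int p gchoose nat (k - r)) *\<^sub>c Y a k b) x =
     (\<Sum>k\<in>{r..<int M}. (of_int p gchoose nat (k - r)) *\<^sub>c Y (Y a k b) (p + q + r - k) x)"
    unfolding zmode_eq_mode clin_sum[OF clin_mode_left] clin_csc[OF clin_mode_left]
  proof (intro sum.cong refl)
    fix k
    have "mode (Y a k b) 0 x = Y (Y a k b) (w' + w - k - 1 - 1 + 0) x"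
      using mode_homogeneous[OF Y_weight[OF a b], of k 0 x] .
    then show "(of_int p gchoose nat (k - r)) *\<^sub>c mode (Y a k b) 0 x = (of_int p gchoose nat (k - r)) *\<^sub>c Y (Y a k b) (p + q + r - k) x"
      by (simp add: p_def q_def algebra_simps)
  qed
  also have "\<dots> = (\<Sum>i<nat (int M - r). (of_int p gchoose i) *\<^sub>c Y (Y a (r + int i) b) (p + q - int i) x)"
    by (rule sum.reindex_bij_witness[where i = "\<lambda>i. r + int i" and j = "\<lambda>k. nat (k - r)"]) (auto simp: algebra_simps)
  also have "\<dots> = fsum (\<lambda>i. (of_int p gchoose i) *\<^sub>c Y (Y a (r + int i) b) (p + q - int i) x)"
    using M by (intro fsum_eq_sum[symmetric]) auto
  also have "\<dots> = fsum (\<lambda>i::nat. ((-1) ^ i * (of_int r gchoose i)) *\<^sub>c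
                (Y a (p + r - int i) (Y b (q + int i) x)
                 - ((-1::complex) powi r) *\<^sub>c Y b (q + r - int i) (Y a (p + int i) x)))"
    by (rule borcherds)
  also have "\<dots> = (\<Sum>i<I. ((-1) ^ i * (of_int r gchoose i)) *\<^sub>c
                (Y a (p + r - int i) (Y b (q + int i) x)
                 - ((-1::complex) powi r) *\<^sub>c Y b (q + r - int i) (Y a (p + int i) x)))"
  proof (rule fsum_eq_sum)
    fix i assume "i \<notin> {..<I}"
    then have "Y b (q + int i) x \<in> {0}" "Y a (p + int i) x \<in> {0}"
      using Y_weight[OF b x, of "q + int i"] Y_weight[OF a x, of "p + int i"]
        N0[of "N + w' - (q + int i) - 1"] N0[of "N + w - (p + int i) - 1"] I
      by (auto simp: p_def q_def)
    then show "((-1) ^ i * (of_int r gchoose i)) *\<^sub>c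
                (Y a (p + r - int i) (Y b (q + int i) x)
                 - ((-1::complex) powi r) *\<^sub>c Y b (q + r - int i) (Y a (p + int i) x)) = 0" by simp
  qed simp
  also have "\<dots> = (\<Sum>i<I. ((-1) ^ i * (of_int r gchoose i)) *\<^sub>c
      (mode a (s + r - int i) (mode b (int i - r - s) x)
       - ((-1) powi r) *\<^sub>c mode b (- int i - s) (mode a (int i + s) x)))"
    unfolding mode_homogeneous[OF a] mode_homogeneous[OF b] p_def q_def
    by (intro sum.cong refl arg_cong2[where f = csc] arg_cong2[where f = minus]
        arg_cong2[where f = "Y a"] arg_cong2[where f = "Y b"]) auto
  finally show ?thesis by (simp only: p_def)
qed

lemma mode_eq_sum_left: "mode u j x = (\<Sum>w | wcomp Y om u w \<noteq> 0. mode (wcomp Y om u w) j x)"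
  by (simp add: clin_sum[OF clin_mode_left, symmetric] sum_wcomp)

lemma zmode_jmode:
  assumes x: "x \<in> V N" and N0: "\<And>w. w < N0 \<Longrightarrow> V w = {0}"
    and M: "\<And>w w' k. k \<ge> int M \<Longrightarrow> Y (wcomp Y om u w) k (wcomp Y om v w') = 0"
    and I: "int I > N + r + s - N0" "int I > N - s - N0"
  shows "zmode Y om (jmode M u v s r) x =
    (\<Sum>i<I. ((-1) ^ i * (of_int r gchoose i)) *\<^sub>c
      (mode u (s + r - int i) (mode v (int i - r - s) x)
       - ((-1) powi r) *\<^sub>c mode v (- int i - s) (mode u (int i + s) x)))"
proof -
  let ?A = "{w. wcomp Y om u w \<noteq> 0}" and ?B = "{w. wcomp Y om v w \<noteq> 0}"
  have "jmode M u v s r = (\<Sum>w\<in>?A. \<Sum>w'\<in>?B. \<Sum>k\<in>{r..<int M}.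
     (of_int (w - 1 + s) gchoose nat (k - r)) *\<^sub>c Y (wcomp Y om u w) k (wcomp Y om v w'))"
    unfolding jmode_def
    by (subst (1) sum_wcomp[of v, symmetric], subst sum.swap)
       (simp add: clin_sum[OF clin_Y] csc.scale_sum_right)
  then have "zmode Y om (jmode M u v s r) x = (\<Sum>w\<in>?A. \<Sum>w'\<in>?B. zmode Y om (\<Sum>k\<in>{r..<int M}.
     (of_int (w - 1 + s) gchoose nat (k - r)) *\<^sub>c Y (wcomp Y om u w) k (wcomp Y om v w')) x)"
    by (simp add: zmode_eq_mode clin_sum[OF clin_mode_left])
  also have "\<dots> = (\<Sum>w\<in>?A. \<Sum>w'\<in>?B. (\<Sum>i<I. ((-1) ^ i * (of_int r gchoose i)) *\<^sub>c
      (mode (wcomp Y om u w) (s + r - int i) (mode (wcomp Y om v w') (int i - r - s) x)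
       - ((-1) powi r) *\<^sub>c mode (wcomp Y om v w') (- int i - s) (mode (wcomp Y om u w) (int i + s) x))))"
    by (intro sum.cong refl zmode_jmode_homogeneous[OF wcomp_in_V wcomp_in_V x N0 M I]) 
  also have "\<dots> = (\<Sum>i<I. ((-1) ^ i * (of_int r gchoose i)) *\<^sub>c (\<Sum>w\<in>?A. \<Sum>w'\<in>?B.
      (mode (wcomp Y om u w) (s + r - int i) (mode (wcomp Y om v w') (int i - r - s) x)
       - ((-1) powi r) *\<^sub>c mode (wcomp Y om v w') (- int i - s) (mode (wcomp Y om u w) (int i + s) x))))"
    unfolding csc.scale_sum_right by (subst (2) sum.swap, subst (1) sum.swap) simp
  also have "\<dots> = (\<Sum>i<I. ((-1) ^ i * (of_int r gchoose i)) *\<^sub>c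
      (mode u (s + r - int i) (mode v (int i - r - s) x)
       - ((-1) powi r) *\<^sub>c mode v (- int i - s) (mode u (int i + s) x)))"
  proof -
    have 1: "(\<Sum>w\<in>?A. \<Sum>w'\<in>?B. mode (wcomp Y om u w) j (mode (wcomp Y om v w') k x)) = mode u j (mode v k x)" for j k
      by (simp add: mode_eq_sum_left[of u] mode_eq_sum_left[of v] clin_sum[OF clin_mode]) (rule sum.swap)
    have 2: "(\<Sum>w\<in>?A. \<Sum>w'\<in>?B. mode (wcomp Y om v w') j (mode (wcomp Y om u w) k x)) = mode v j (mode u k x)" for j k
      by (simp add: mode_eq_sum_left[of u] mode_eq_sum_left[of v] clin_sum[OF clin_mode])
    show ?thesis by (simp add: sum_subtractf 1 2 flip: csc.scale_sum_right)
  qed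
  finally show ?thesis .
qed

end

section \<open>Traces over the eigenspaces of the involution\<close>

locale voa_involution = voa Y vac om c
  for Y :: "'v::cvector \<Rightarrow> int \<Rightarrow> 'v \<Rightarrow> 'v" and vac om :: 'v and c :: complex +
  fixes t :: "'v \<Rightarrow> 'v"
  assumes aut: "is_invol_aut Y vac om t"
begin

lemma clin_t: "clin t" and t_om: "t om = om" and t_Y: "t (Y a n b) = Y (t a) n (t b)" and t_t [simp]: "t (t x) = x"
  using aut by (auto simp: is_invol_aut_def)

lemma t_eq_0_iff: "t x = 0 \<longleftrightarrow> x = 0"
  using clin_0[OF clin_t] by (metis t_t)

lemma t_V: "x \<in> V w \<Longrightarrow> t x \<in> V w"
  using t_Y[of om 1 x] by (simp add: wtsp_def Lop_def t_om clin_csc[OF clin_t])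

lemma wcomp_t: "wcomp Y om (t x) w = t (wcomp Y om x w)"
proof -
  let ?S = "{w. wcomp Y om x w \<noteq> 0}"
  have "t x = (\<Sum>w\<in>?S. t (wcomp Y om x w))"
    using clin_sum[OF clin_t, of "wcomp Y om x" ?S] by (simp add: sum_wcomp)
  then have "wcomp Y om (t x) = (\<lambda>w. if w \<in> ?S then t (wcomp Y om x w) else 0)"
    using wcomp_eqI[of ?S "\<lambda>w. t (wcomp Y om x w)"] finite_wcomp wcomp_in_V t_V by simp
  then show ?thesis using clin_0[OF clin_t] by simp
qed

lemma t_mode: "t (mode a j x) = mode (t a) j (t x)"
  unfolding mode_def wsum_def by (simp add: wcomp_t t_eq_0_iff clin_sum[OF clin_t] t_Y)

text \<open>The sign is encoded as a truth value, \<open>True\<close> for V+, so that an odd mode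
  acts on it by negation.\<close>

definition eigensp :: "bool \<Rightarrow> 'v set" where
  "eigensp e = {x. t x = (if e then x else - x)}"

definition W :: "bool \<Rightarrow> int \<Rightarrow> 'v set" where
  "W e N = eigensp e \<inter> V N"

lemma findim_W: "findim (W e N)"
  unfolding W_def
proof (rule findim_Int[OF findim_V])
  show "csc.subspace (eigensp e)"
    by (auto simp: csc.subspace_def eigensp_def clin_0[OF clin_t] clin_add[OF clin_t] clin_csc[OF clin_t])
qed

lemma mode_even: "t a = a \<Longrightarrow> x \<in> W e N \<Longrightarrow> mode a j x \<in> W e (N - j)"
  by (auto simp: W_def eigensp_def mode_weight t_mode clin_minus[OF clin_mode] split: if_splits)

lemma mode_odd: "t a = - a \<Longrightarrow> x \<in> W e N \<Longrightarrow> mode a j x \<in> W (\<not> e) (N - j)"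
  by (auto simp: W_def eigensp_def mode_weight t_mode clin_minus[OF clin_mode] clin_minus[OF clin_mode_left]
      split: if_splits)

lemma zmode_even: "t a = a \<Longrightarrow> x \<in> W e N \<Longrightarrow> zmode Y om a x \<in> W e N"
  using mode_even[of a x e N 0] by (simp add: zmode_eq_mode)

text \<open>Each summand is bilinear in the components of \<open>u\<close> and \<open>v\<close>, so
  the two signs cancel.\<close>

lemma t_jmode:
  assumes "t u = - u" "t v = - v"
  shows "t (jmode M u v s r) = jmode M u v s r"
proof -
  have "t (wcomp Y om u w) = - wcomp Y om u w" for w
  proof -
    have "wcomp Y om (- u) w = - wcomp Y om u w"
    proof -
      let ?S = "{w. wcomp Y om u w \<noteq> 0}"
      have "- u = (\<Sum>w\<in>?S. - wcomp Y om u w)" by (simp add: sum_negf sum_wcomp)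
      then have "wcomp Y om (- u) = (\<lambda>w. if w \<in> ?S then - wcomp Y om u w else 0)"
        using wcomp_eqI[of ?S "\<lambda>w. - wcomp Y om u w"] finite_wcomp
          findim_scale[OF findim_V wcomp_in_V, of "- 1"] by (simp add: csc.scale_minus_left csc_one)
      then show ?thesis by simp
    qed
    then show ?thesis using wcomp_t[of u w] assms by simp
  qed
  then show ?thesis
    unfolding jmode_def
    by (simp add: clin_sum[OF clin_t] clin_csc[OF clin_t] t_Y assms clin_minus[OF clin_Y] clin_minus[OF clin_Y_left])
qed

lemma ctrace_V_split:
  assumes f: "clin f" and fW: "\<And>e x. x \<in> W e N \<Longrightarrow> f x \<in> W e N"
  shows "ctrace f (V N) = ctrace f (W True N) + ctrace f (W False N)"
proof (rule ctrace_direct_sum[where ?p1.0 = "\<lambda>x. (1/2) *\<^sub>c (x + t x)" and ?p2.0 = "\<lambda>x. (1/2) *\<^sub>c (x - t x)"])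
  have halves: "(1/2) *\<^sub>c x + (1/2) *\<^sub>c x = x" for x :: 'v
    by (simp add: csc_one flip: csc.scale_left_distrib)
  show "clin (\<lambda>x. (1/2) *\<^sub>c (x + t x))" "clin (\<lambda>x. (1/2) *\<^sub>c (x - t x))"
    by (auto simp: clin_def clin_add[OF clin_t] clin_csc[OF clin_t] csc_csc csc.scale_right_distrib
        csc.scale_right_diff_distrib algebra_simps)
  show "(1/2) *\<^sub>c (x + t x) \<in> W True N" "(1/2) *\<^sub>c (x - t x) \<in> W False N" if "x \<in> V N" for x
    using that t_V[OF that]
    by (auto simp: W_def eigensp_def clin_csc[OF clin_t] clin_add[OF clin_t] clin_diff[OF clin_t] add.commute
        findim_scale[OF findim_V] findim_add[OF findim_V] findim_diff[OF findim_V] simp flip: csc.scale_minus_right)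
  show "(1/2) *\<^sub>c (x + t x) = x" if "x \<in> W True N" for x
    using that halves by (simp add: W_def eigensp_def csc.scale_right_distrib)
  show "(1/2) *\<^sub>c (x - t x) = x" if "x \<in> W False N" for x
    using that halves by (simp add: W_def eigensp_def csc.scale_right_distrib)
  show sum: "(1/2) *\<^sub>c (x + t x) + (1/2) *\<^sub>c (x - t x) = x" for x
    using halves[of x] by (simp flip: csc.scale_right_distrib)
  show "f x \<in> V N" if "x \<in> V N" for x
  proof -
    have "f x = f ((1/2) *\<^sub>c (x + t x)) + f ((1/2) *\<^sub>c (x - t x))"
      using sum[of x] by (simp flip: clin_add[OF f])
    moreover have "f ((1/2) *\<^sub>c (x + t x)) \<in> V N" "f ((1/2) *\<^sub>c (x - t x)) \<in> V N"
    proof -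
      have "(1/2) *\<^sub>c (x + t x) \<in> W True N" "(1/2) *\<^sub>c (x - t x) \<in> W False N"
        using that t_V[OF that]
        by (auto simp: W_def eigensp_def clin_csc[OF clin_t] clin_add[OF clin_t] clin_diff[OF clin_t] add.commute
            findim_scale[OF findim_V] findim_add[OF findim_V] findim_diff[OF findim_V] simp flip: csc.scale_minus_right)
      from this[THEN fW] show "f ((1/2) *\<^sub>c (x + t x)) \<in> V N" "f ((1/2) *\<^sub>c (x - t x)) \<in> V N"
        by (simp_all add: W_def)
    qed
    ultimately show ?thesis by (simp add: findim_add[OF findim_V])
  qed
qed (use f fW in \<open>auto simp: findim_V findim_W\<close>, auto simp: W_def)

end

text \<open>The bounds \<open>M\<close> on the modes and \<open>N0\<close> on the weights are fixed
  once, so that all sums become finite. Positivity of \<open>M\<close> puts the index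
  \<open>m = 0\<close> into the range \<open>m < M\<close>.\<close>

locale odd_pair = voa_involution Y vac om c t
  for Y :: "'v::cvector \<Rightarrow> int \<Rightarrow> 'v \<Rightarrow> 'v" and vac om :: 'v and c :: complex and t +
  fixes u v :: 'v and M :: nat and N0 :: int
  assumes u: "t u = - u" and v: "t v = - v" and M_pos: "M > 0"
    and modes_vanish: "k \<ge> int M \<Longrightarrow> Y (wcomp Y om u w) k (wcomp Y om v w') = 0"
    and V_vanish: "N < N0 \<Longrightarrow> wtsp Y om N = {0}"
begin

section \<open>Traces attached to a pair of odd vectors\<close>

lemma zmode_linear: "zmode Y om (\<Sum>i\<in>A. a i *\<^sub>c f i) = (\<lambda>x. \<Sum>i\<in>A. a i *\<^sub>c zmode Y om (f i) x)"
  by (simp add: zmode_eq_mode clin_sum[OF clin_mode_left] clin_csc[OF clin_mode_left] fun_eq_iff)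

lemma modes_vanish_v: "k \<ge> int M \<Longrightarrow> Y (wcomp Y om u w) k v = 0"
  by (subst sum_wcomp[of v, symmetric]) (simp add: clin_sum[OF clin_Y] modes_vanish)

lemma W_vanish: "N < N0 \<Longrightarrow> W e N = {0}"
  using findim_0[OF findim_W] V_vanish by (auto simp: W_def)

definition T :: "bool \<Rightarrow> int \<Rightarrow> int \<Rightarrow> complex" where
  "T e N j = ctrace (mode u j \<circ> mode v (- j)) (W e N)"

text \<open>An intermediate quantity: \<open>r = 0\<close> yields traces of commutators of modes,
  while \<open>s = 0\<close> yields the building blocks of the \<open>Z e N m\<close>.\<close>

definition G :: "bool \<Rightarrow> int \<Rightarrow> int \<Rightarrow> int \<Rightarrow> complex" where
  "G e N s r = ctrace (zmode Y om (jmode M u v s r)) (W e N)"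

text \<open>For \<open>e = True\<close> this is the coefficient of q^N in the trace function of
  u[m]v on V+, with the factor q^(-c/24) left out.\<close>

definition Z :: "bool \<Rightarrow> int \<Rightarrow> int \<Rightarrow> complex" where
  "Z e N m = ctrace (zmode Y om (sqmode Y om u m v)) (W e N)"

text \<open>Cyclicity for \<open>mode u j\<close>, which maps \<open>W e N\<close> to the opposite
  eigenspace in weight \<open>N - j\<close>, and \<open>mode v (- j)\<close>, which maps
  back.\<close>

lemma T_swap: "ctrace (mode v (- j) \<circ> mode u j) (W e N) = T (\<not> e) (N - j) j"
  unfolding T_def
proof (rule ctrace_cyclic[OF findim_W findim_W clin_mode clin_mode])
  show "mode u j x \<in> W (\<not> e) (N - j)" if "x \<in> W e N" for x
    using mode_odd[OF u that] .
  show "mode v (- j) x \<in> W e N" if "x \<in> W (\<not> e) (N - j)" for x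
    using mode_odd[OF v that, of "- j"] by simp
qed

text \<open>The second case holds because \<open>mode v (- j)\<close> raises the weight to
  \<open>N + j\<close>.\<close>

lemma T_vanish:
  assumes "N < N0 \<or> N + j < N0"
  shows "T e N j = 0"
proof (cases "N < N0")
  case True
  then show ?thesis by (simp add: T_def W_vanish)
next
  case False
  then have "V (N + j) = {0}" using assms V_vanish by simp
  then have "(mode u j \<circ> mode v (- j)) x = 0" if "x \<in> W e N" for x
    using mode_weight[of x N v "- j"] that clin_0[OF clin_mode] by (simp add: W_def)
  then have "T e N j = ctrace (\<lambda>x. 0) (W e N)" unfolding T_def by (intro ctrace_cong findim_W) auto
  then show ?thesis by (simp add: findim_W)
qed

lemma Z_vanish: "N < N0 \<Longrightarrow> Z e N m = 0"
  by (simp add: Z_def W_vanish)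

lemma G_eq:
  assumes I: "int I > N + r + s - N0" "int I > N - s - N0"
  shows "G e N s r = (\<Sum>i<I. ((-1) ^ i * (of_int r gchoose i)) *
    (T e N (s + r - int i) - ((-1) powi r) * T (\<not> e) (N - (int i + s)) (int i + s)))"
proof -
  let ?a = "\<lambda>i x. mode u (s + r - int i) (mode v (- (s + r - int i)) x)"
  let ?b = "\<lambda>i x. mode v (- (int i + s)) (mode u (int i + s) x)"
  have a: "?a i x \<in> W e N" if "x \<in> W e N" for i x
    using mode_odd[OF u mode_odd[OF v that]] by (metis diff_add_cancel diff_minus_eq_add not_not)
  have b: "?b i x \<in> W e N" if "x \<in> W e N" for i x
    using mode_odd[OF v mode_odd[OF u that]] by (metis diff_add_cancel diff_minus_eq_add not_not)
  have "G e N s r = ctrace (\<lambda>x. \<Sum>i<I. ((-1) ^ i * (of_int r gchoose i)) *\<^sub>c (?a i x - ((-1) powi r) *\<^sub>c ?b i x)) (W e N)"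
    unfolding G_def
  proof (rule ctrace_cong[OF findim_W])
    fix x assume "x \<in> W e N"
    then have "x \<in> V N" by (simp add: W_def)
    from zmode_jmode[OF this V_vanish modes_vanish I]
    have "zmode Y om (jmode M u v s r) x =
      (\<Sum>i<I. ((-1) ^ i * (of_int r gchoose i)) *\<^sub>c
      (mode u (s + r - int i) (mode v (int i - r - s) x)
       - ((-1) powi r) *\<^sub>c mode v (- int i - s) (mode u (int i + s) x)))" by blast
    moreover have "int i - r - s = - (s + r - int i)" "- int i - s = - (int i + s)" for i by auto
    ultimately show "zmode Y om (jmode M u v s r) x = (\<Sum>i<I. ((-1) ^ i * (of_int r gchoose i)) *\<^sub>c (?a i x - ((-1) powi r) *\<^sub>c ?b i x))"
      by (simp only:)
  qed
  also have "\<dots> = (\<Sum>i<I. ((-1) ^ i * (of_int r gchoose i)) * ctrace (\<lambda>x. ?a i x - ((-1) powi r) *\<^sub>c ?b i x) (W e N))"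
    using a b by (intro ctrace_sum findim_W findim_diff findim_scale) auto
  also have "\<dots> = (\<Sum>i<I. ((-1) ^ i * (of_int r gchoose i)) *
    (T e N (s + r - int i) - ((-1) powi r) * T (\<not> e) (N - (int i + s)) (int i + s)))"
  proof (intro sum.cong refl arg_cong2[where f = "(*)"])
    fix i
    have "ctrace (\<lambda>x. ?a i x - ((-1) powi r) *\<^sub>c ?b i x) (W e N) = ctrace (?a i) (W e N) - ctrace (\<lambda>x. ((-1) powi r) *\<^sub>c ?b i x) (W e N)"
      using a b by (intro ctrace_diff findim_W findim_scale) auto
    also have "ctrace (\<lambda>x. ((-1) powi r) *\<^sub>c ?b i x) (W e N) = ((-1) powi r) * ctrace (?b i) (W e N)"
      using b by (intro ctrace_scale findim_W) auto
    also have "ctrace (?b i) (W e N) = T (\<not> e) (N - (int i + s)) (int i + s)"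
      using T_swap[of "int i + s" e N] by (simp add: comp_def)
    also have "ctrace (?a i) (W e N) = T e N (s + r - int i)"
      by (simp add: T_def comp_def)
    finally show "ctrace (\<lambda>x. ?a i x - ((-1) powi r) *\<^sub>c ?b i x) (W e N) =
      T e N (s + r - int i) - ((-1) powi r) * T (\<not> e) (N - (int i + s)) (int i + s)" .
  qed
  finally show ?thesis .
qed

text \<open>For \<open>r = 0\<close> only the term i = 0 of the Borcherds identity survives, which
  is the commutator formula.\<close>

lemma G_commutator: "G e N j 0 = T e N j - T (\<not> e) (N - j) j"
proof -
  obtain I :: nat where I: "int I > N + 0 + j - N0" "int I > N - j - N0" "I > 0"
    by (rule that[of "nat (\<bar>N + j - N0\<bar> + \<bar>N - j - N0\<bar>) + 1"]) auto
  have "G e N j 0 = (\<Sum>i\<in>{0}. ((-1) ^ i * (of_int 0 gchoose i)) *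
    (T e N (j + 0 - int i) - ((-1) powi 0) * T (\<not> e) (N - (int i + j)) (int i + j)))"
    unfolding G_eq[OF I(1,2)] using I(3) by (intro sum.mono_neutral_right) (auto simp: gr0_conv_Suc)
  then show ?thesis by simp
qed

lemma zmode_jmode_W: "x \<in> W e N \<Longrightarrow> zmode Y om (jmode M u v s r) x \<in> W e N"
  using zmode_even[OF t_jmode[OF u v]] .

lemma Z_eq_G: "Z e N m = (\<Sum>r\<in>{m..<int M}. sqcoef 1 r m * G e N 0 r)"
proof -
  have "Z e N m = ctrace (\<lambda>x. \<Sum>r\<in>{m..<int M}. sqcoef 1 r m *\<^sub>c zmode Y om (jmode M u v 0 r) x) (W e N)"
    unfolding Z_def zmode_linear[symmetric] using sqmode_eq_jmode[of M u v m] modes_vanish_v by simp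
  also have "\<dots> = (\<Sum>r\<in>{m..<int M}. sqcoef 1 r m * G e N 0 r)"
    unfolding G_def by (intro ctrace_sum findim_W zmode_jmode_W) auto
  finally show ?thesis .
qed

lemma t_sqmode: "t (sqmode Y om u m v) = sqmode Y om u m v"
  using sqmode_eq_jmode[of M u v m] modes_vanish_v t_jmode[OF u v]
  by (simp add: clin_sum[OF clin_t] clin_csc[OF clin_t])

lemma zmode_sqmode_W: "x \<in> W e N \<Longrightarrow> zmode Y om (sqmode Y om u m v) x \<in> W e N"
  using zmode_even[OF t_sqmode] .

text \<open>The trace of the commutator formula, read as a difference equation for \<open>T\<close>
  with a right side polynomial in \<open>j\<close>.\<close>

lemma sum_Z: "(\<Sum>m<M. of_int j ^ m / fact m * Z e N (int m)) = T e N j - T (\<not> e) (N - j) j"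
proof -
  have "G e N j 0 = ctrace (\<lambda>x. \<Sum>m<M. (of_int j ^ m / fact m) *\<^sub>c zmode Y om (sqmode Y om u (int m) v) x) (W e N)"
    unfolding G_def zmode_linear[symmetric] using sum_sqmode_eq_jmode[of M u v j] modes_vanish_v by simp
  also have "\<dots> = (\<Sum>m<M. of_int j ^ m / fact m * Z e N (int m))"
    unfolding Z_def by (intro ctrace_sum findim_W zmode_sqmode_W) auto
  finally show ?thesis by (simp add: G_commutator)
qed

text \<open>For a negative index the binomial expansions do not terminate; boundedness of the
  weights cuts both sums at \<open>Q\<close>. The first is indexed by l = s + i + 1, and upper
  negation makes both binomials polynomials in the mode index.\<close>

lemma G_negative:
  assumes Q: "int Q > N - N0"
  shows "G e N 0 (- int s - 1) =
    (\<Sum>l\<in>{1..Q}. (of_int (int l - 1) gchoose s) * T e N (- int l)) +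
    (\<Sum>i\<le>Q. (of_int (- int i - 1) gchoose s) * T (\<not> e) (N - int i) (int i))"
proof -
  have "G e N 0 (- int s - 1) = (\<Sum>i<Suc Q. ((-1) ^ i * (of_int (- int s - 1) gchoose i)) *
    (T e N (0 + (- int s - 1) - int i) - ((-1) powi (- int s - 1)) * T (\<not> e) (N - (int i + 0)) (int i + 0)))"
    by (rule G_eq) (use Q in auto)
  also have "\<dots> = (\<Sum>i\<le>Q. (of_int (int (s + i)) gchoose s) * T e N (- int (s + i + 1))) +
     (\<Sum>i\<le>Q. (-1) ^ s * (of_int (int (s + i)) gchoose s) * T (\<not> e) (N - int i) (int i))"
  proof -
    have "(-1) powi (- int s - 1) = - ((-1) ^ s :: complex)"
      by (simp add: power_int_diff power_int_minus flip: power_inverse)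
    moreover have "0 + (- int s - 1) - int i = - int (s + i + 1)" for i by simp
    moreover have "X * (a - (- y) * b) = X * a + y * X * b" for X a y b :: complex
      by (simp add: algebra_simps)
    ultimately show ?thesis
      unfolding gchoose_neg lessThan_Suc_atMost sum.distrib[symmetric]
      by (intro sum.cong refl) (simp only: add_0_right)
  qed
  also have "(\<Sum>i\<le>Q. (of_int (int (s + i)) gchoose s) * T e N (- int (s + i + 1))) =
     (\<Sum>l\<in>{1..Q}. (of_int (int l - 1) gchoose s) * T e N (- int l))"
  proof -
    have "(\<Sum>i\<le>Q. (of_int (int (s + i)) gchoose s) * T e N (- int (s + i + 1))) =
      (\<Sum>l\<in>{s + 1..Q + s + 1}. (of_int (int l - 1) gchoose s) * T e N (- int l))"
      by (rule sum.reindex_bij_witness[where i = "\<lambda>l. l - (s + 1)" and j = "\<lambda>i. s + i + 1"]) auto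
    \<comment> \<open>The sum may start at 1 because the binomial coefficient vanishes for 1 <= l <=
      s; afterwards the range no longer depends on \<open>s\<close> once the terms beyond
      \<open>Q\<close> are dropped.\<close>
    also have "\<dots> = (\<Sum>l\<in>{1..Q + s + 1}. (of_int (int l - 1) gchoose s) * T e N (- int l))"
    proof (rule sum.mono_neutral_left)
      show "\<forall>l\<in>{1..Q + s + 1} - {s + 1..Q + s + 1}. (of_int (int l - 1) gchoose s) * T e N (- int l) = 0"
      proof
        fix l assume l: "l \<in> {1..Q + s + 1} - {s + 1..Q + s + 1}"
        then have "of_int (int l - 1) = (of_nat (l - 1) :: complex)" by (simp add: of_nat_diff)
        then have "(of_int (int l - 1) gchoose s :: complex) = of_nat ((l - 1) choose s)"
          by (simp only: binomial_gbinomial)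
        also have "(l - 1) choose s = 0" using l by (intro binomial_eq_0) auto
        finally show "(of_int (int l - 1) gchoose s) * T e N (- int l) = 0" by simp
      qed
    qed auto
    also have "\<dots> = (\<Sum>l\<in>{1..Q}. (of_int (int l - 1) gchoose s) * T e N (- int l))"
      using Q by (intro sum.mono_neutral_right) (auto intro!: T_vanish)
    finally show ?thesis .
  qed
  finally have eq: "G e N 0 (- int s - 1) = (\<Sum>l\<in>{1..Q}. (of_int (int l - 1) gchoose s) * T e N (- int l)) +
     (\<Sum>i\<le>Q. (-1) ^ s * (of_int (int (s + i)) gchoose s) * T (\<not> e) (N - int i) (int i))" .
  have "(-1) ^ s * (of_int (int (s + i)) gchoose s) = (of_int (- int i - 1) gchoose s :: complex)" for i
  proof -
    have "of_int (- int i - 1) = (- of_nat (i + 1) :: complex)"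
      "of_nat (i + 1) + of_nat s - 1 = (of_int (int (s + i)) :: complex)" by simp_all
    then show ?thesis
      using gbinomial_minus[of "of_nat (i + 1) :: complex" s] by (simp only:)
  qed
  then show ?thesis unfolding eq by (simp only:)
qed

section \<open>Solving the difference equation for the traces\<close>

definition P :: "bool \<Rightarrow> int \<Rightarrow> int \<Rightarrow> complex" where
  "P e N j = (\<Sum>m<M. of_int j ^ m / fact m * Z e N (int m))"

lemma T_telescope_pos:
  "T e N j = (\<Sum>a<K. P (if even a then e else \<not> e) (N - int a * j) j) + T (if even K then e else \<not> e) (N - int K * j) j"
proof (induction K)
  case (Suc K)
  let ?e = "if even K then e else \<not> e"
  have "T ?e (N - int K * j) j = P ?e (N - int K * j) j + T (\<not> ?e) (N - int K * j - j) j"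
    using sum_Z[of j ?e "N - int K * j"] by (simp add: P_def)
  moreover have "N - int K * j - j = N - int (Suc K) * j" by (simp add: algebra_simps)
  moreover have "(\<not> ?e) = (if even (Suc K) then e else \<not> e)" by simp
  ultimately have "T ?e (N - int K * j) j = P ?e (N - int K * j) j + T (if even (Suc K) then e else \<not> e) (N - int (Suc K) * j) j"
    by (simp only:)
  then show ?case using Suc.IH by (simp only: sum.lessThan_Suc add.assoc)
qed simp

text \<open>For mode \<open>- j\<close> the equation is used in the opposite direction, so that
  positive \<open>j\<close> again leads to lower weights. Hence the minus sign and the range
  starting at 1.\<close>

lemma T_telescope_neg:
  "T e N (- j) = T (if even K then e else \<not> e) (N - int K * j) (- j)
     - (\<Sum>a\<in>{1..K}. P (if even a then e else \<not> e) (N - int a * j) (- j))"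
proof (induction K)
  case (Suc K)
  let ?e = "if even K then e else \<not> e" and ?e' = "if even (Suc K) then e else \<not> e"
  have "P ?e' (N - int (Suc K) * j) (- j) = T ?e' (N - int (Suc K) * j) (- j) - T (\<not> ?e') (N - int (Suc K) * j - - j) (- j)"
    using sum_Z[of "- j" ?e' "N - int (Suc K) * j"] by (simp only: P_def)
  moreover have "N - int (Suc K) * j - - j = N - int K * j" by (simp add: algebra_simps)
  moreover have "(\<not> ?e') = ?e" by simp
  ultimately have "T ?e (N - int K * j) (- j) = T ?e' (N - int (Suc K) * j) (- j) - P ?e' (N - int (Suc K) * j) (- j)"
    by (simp only:) simp
  moreover have "{1..Suc K} = insert (Suc K) {1..K}" by auto
  ultimately show ?case using Suc.IH by (simp del: if_cancel even_Suc)
qed simp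

lemma
  assumes Q: "int Q > N - N0" and l: "l \<ge> 1"
  shows T_pos: "T (\<not> e) (N - int l) (int l) = (\<Sum>a\<in>{1..Q}. P (if even a then e else \<not> e) (N - int a * int l) (int l))"
    and T_neg: "T e N (- int l) = - (\<Sum>a\<in>{1..Q}. P (if even a then e else \<not> e) (N - int a * int l) (- int l))"
proof -
  have "int Q * 1 \<le> int Q * int l" using l by (intro mult_left_mono) auto
  \<comment> \<open>After \<open>Q\<close> steps of length \<open>l\<close> the weight is below
    \<open>N0\<close>, so the remainder of the telescoping vanishes. Starting one step down in the
    first formula gives both formulas the same parities and weights.\<close>
  then have QN: "N - int Q * int l < N0" using Q by simp
  have "T (\<not> e) (N - int l) (int l) = (\<Sum>a<Q. P (if even a then \<not> e else \<not> \<not> e) (N - int l - int a * int l) (int l))"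
    using T_telescope_pos[of "\<not> e" "N - int l" "int l" Q] QN by (simp add: T_vanish)
  also have "\<dots> = (\<Sum>a\<in>{1..Q}. P (if even a then e else \<not> e) (N - int a * int l) (int l))"
    by (rule sum.reindex_bij_witness[where i = "\<lambda>a. a - 1" and j = Suc]) (auto simp: algebra_simps)
  finally show "T (\<not> e) (N - int l) (int l) = (\<Sum>a\<in>{1..Q}. P (if even a then e else \<not> e) (N - int a * int l) (int l))" .
  show "T e N (- int l) = - (\<Sum>a\<in>{1..Q}. P (if even a then e else \<not> e) (N - int a * int l) (- int l))"
    using T_telescope_neg[of e N "int l" Q] QN by (simp add: T_vanish)
qed

section \<open>The recursion for a single coefficient\<close>

lemma Z_0: "Z e N 0 = T e N 0 - T (\<not> e) N 0"
proof -
  have "(\<Sum>m<M. of_int 0 ^ m / fact m * Z e N (int m)) = (\<Sum>m\<in>{0}. of_int 0 ^ m / fact m * Z e N (int m))"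
    using M_pos by (intro sum.mono_neutral_right) (auto simp: power_0_left)
  then show ?thesis using sum_Z[of 0 e N] by simp
qed

lemma Z_neg_expand:
  assumes n: "n \<ge> 1" and Q: "int Q > N - N0"
  shows "Z e N (- int n) =
    (\<Sum>l\<in>{1..Q}. of_nat l ^ (n - 1) / fact (n - 1) * T e N (- int l)) +
    (\<Sum>i\<le>Q. (- of_nat i) ^ (n - 1) / fact (n - 1) * T (\<not> e) (N - int i) (int i)) +
    (\<Sum>m<M. (-1) ^ m * of_nat ((n + m - 1) choose m) * of_real (bern (n + m)) / fact (n + m) * Z e N (int m)) +
    (if n = 1 then Z e N 0 else 0)"
proof -
  let ?b = "\<lambda>m. (-1) ^ m * of_nat ((n + m - 1) choose m) * of_real (bern (n + m)) / fact (n + m) :: complex"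
  \<comment> \<open>Negative \<open>r\<close> give products of modes, with weights simplified by
    \<open>sum_sqcoef_gchoose\<close>; nonnegative \<open>r\<close> give the traces of the u[m]v
    through \<open>sqcoef_reflect\<close>.\<close>
  have "{- int n..<int M} = {- int n..-1} \<union> {0..<int M}" by auto
  then have "Z e N (- int n) = (\<Sum>r\<in>{- int n..-1}. sqcoef 1 r (- int n) * G e N 0 r) + (\<Sum>r\<in>{0..<int M}. sqcoef 1 r (- int n) * G e N 0 r)"
    unfolding Z_eq_G by (simp only:) (rule sum.union_disjoint; auto)
  also have "(\<Sum>r\<in>{- int n..-1}. sqcoef 1 r (- int n) * G e N 0 r) = (\<Sum>s<n. sqcoef 1 (- int s - 1) (- int n) * G e N 0 (- int s - 1))"
    by (rule sum.reindex_bij_witness[where i = "\<lambda>s. - int s - 1" and j = "\<lambda>r. nat (- r - 1)"]) auto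
  also have "\<dots> = (\<Sum>l\<in>{1..Q}. (\<Sum>s<n. sqcoef 1 (- int s - 1) (- int n) * (of_int (int l - 1) gchoose s)) * T e N (- int l)) +
    (\<Sum>i\<le>Q. (\<Sum>s<n. sqcoef 1 (- int s - 1) (- int n) * (of_int (- int i - 1) gchoose s)) * T (\<not> e) (N - int i) (int i))"
    unfolding G_negative[OF Q] distrib_left sum.distrib sum_distrib_left sum_distrib_right mult.assoc
    by (intro arg_cong2[where f = "(+)"] sum.swap)
  also have "\<dots> = (\<Sum>l\<in>{1..Q}. of_nat l ^ (n - 1) / fact (n - 1) * T e N (- int l)) +
    (\<Sum>i\<le>Q. (- of_nat i) ^ (n - 1) / fact (n - 1) * T (\<not> e) (N - int i) (int i))"
    using sum_sqcoef_gchoose[OF n, of "- int _"] sum_sqcoef_gchoose[OF n, of "int _"] by simp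
  also have "(\<Sum>r\<in>{0..<int M}. sqcoef 1 r (- int n) * G e N 0 r) = (\<Sum>r<M. sqcoef 1 (int r) (- int n) * G e N 0 (int r))"
    by (rule sum.reindex_bij_witness[where i = int and j = nat]) auto
  also have "\<dots> = (\<Sum>r<M. (\<Sum>m\<le>r. ?b m * sqcoef 1 (int r) (int m)) * G e N 0 (int r)) +
     (\<Sum>r<M. if r = 0 \<and> n = 1 then G e N 0 0 else 0)"
    unfolding sqcoef_reflect[OF n] distrib_right sum.distrib
    by (intro arg_cong2[where f = "(+)"] sum.cong) auto
  \<comment> \<open>The exceptional term of \<open>sqcoef_reflect\<close> is a commutator of zero
    modes, which is also what \<open>Z e N 0\<close> measures.\<close>
  also have "(\<Sum>r<M. if r = 0 \<and> n = 1 then G e N 0 0 else 0) = (if n = 1 then Z e N 0 else 0)"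
    using M_pos Z_0[of e N] G_commutator[of e N 0] by (auto simp: sum.delta)
  also have "(\<Sum>r<M. (\<Sum>m\<le>r. ?b m * sqcoef 1 (int r) (int m)) * G e N 0 (int r)) = (\<Sum>m<M. ?b m * Z e N (int m))"
  proof -
    have "(\<Sum>m<M. ?b m * Z e N (int m)) = (\<Sum>m<M. \<Sum>r\<in>{m..<M}. ?b m * (sqcoef 1 (int r) (int m) * G e N 0 (int r)))"
    proof (intro sum.cong refl)
      fix m
      have "Z e N (int m) = (\<Sum>r\<in>{m..<M}. sqcoef 1 (int r) (int m) * G e N 0 (int r))"
        unfolding Z_eq_G by (rule sum.reindex_bij_witness[where i = int and j = nat]) auto
      then show "?b m * Z e N (int m) = (\<Sum>r\<in>{m..<M}. ?b m * (sqcoef 1 (int r) (int m) * G e N 0 (int r)))"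
        by (simp add: sum_distrib_left)
    qed
    also have "\<dots> = (\<Sum>r<M. \<Sum>m\<le>r. ?b m * (sqcoef 1 (int r) (int m) * G e N 0 (int r)))"
      unfolding sum.Sigma[OF finite_lessThan ballI[OF finite_atLeastLessThan]]
        sum.Sigma[OF finite_lessThan ballI[OF finite_atMost]]
      by (rule sum.reindex_bij_witness[where i = "\<lambda>(a, b). (b, a)" and j = "\<lambda>(a, b). (b, a)"]) auto
    finally show ?thesis by (simp add: sum_distrib_right mult.assoc)
  qed
  finally show ?thesis by (simp add: add.assoc)
qed

text \<open>The Bernoulli weights are constant terms of the F_k, except for n + m = 1, where F_1 = 0
  but B_1 = -1/2. This defect joins the other terms special to \<open>n = 1\<close>.\<close>

lemma Z_neg_constant_term:
  assumes n: "n \<ge> 1" and Q: "int Q > N - N0"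
  shows "Z e N (- int n) =
    (if n = 1 then (T e N 0 + T (\<not> e) N 0) / 2 else 0) +
    (\<Sum>m<M. zcoef n m * Fis (n + m) $ 0 * Z e N (int m)) +
    (\<Sum>l\<in>{1..Q}. of_nat l ^ (n - 1) / fact (n - 1) * T e N (- int l) +
       (- of_nat l) ^ (n - 1) / fact (n - 1) * T (\<not> e) (N - int l) (int l))"
proof -
  let ?b = "\<lambda>m. (-1) ^ m * of_nat ((n + m - 1) choose m) * of_real (bern (n + m)) / fact (n + m) :: complex"
  have b: "?b m = zcoef n m * Fis (n + m) $ 0 + (if n = 1 \<and> m = 0 then - 1 / 2 else 0)" for m
  proof (cases "n + m = 1")
    case True
    then have "n = 1" "m = 0" using n by auto
    then show ?thesis using bern_1 Fis_1 by simp
  next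
    case False
    then show ?thesis using Fis_nth_0[of "n + m"] n by (auto simp: zcoef_def)
  qed
  have "(\<Sum>m<M. ?b m * Z e N (int m)) = (\<Sum>m<M. zcoef n m * Fis (n + m) $ 0 * Z e N (int m)) +
      (\<Sum>m<M. if m = 0 \<and> n = 1 then - 1 / 2 * Z e N 0 else 0)"
    unfolding b sum.distrib[symmetric] by (intro sum.cong) (auto simp: distrib_right)
  also have "(\<Sum>m<M. if m = 0 \<and> n = 1 then - 1 / 2 * Z e N 0 else 0) = (if n = 1 then - 1 / 2 * Z e N 0 else 0)"
    using M_pos by (auto simp: sum.delta)
  finally have B: "(\<Sum>m<M. ?b m * Z e N (int m)) = (\<Sum>m<M. zcoef n m * Fis (n + m) $ 0 * Z e N (int m)) +
      (if n = 1 then - 1 / 2 * Z e N 0 else 0)" .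
  have "(\<Sum>i\<le>Q. (- of_nat i) ^ (n - 1) / fact (n - 1) * T (\<not> e) (N - int i) (int i)) =
    (if n = 1 then T (\<not> e) N 0 else 0) + (\<Sum>i\<in>{1..Q}. (- of_nat i) ^ (n - 1) / fact (n - 1) * T (\<not> e) (N - int i) (int i))"
    using n by (subst sum.atMost_shift) (simp add: sum.atLeast1_atMost_eq power_0_left del: of_nat_Suc)
  moreover have "A + (i1 + D) + (C + i2) + i3 = i0 + C + (A + D)" if "i1 + i2 + i3 = i0"
    for A D C i0 i1 i2 i3 :: complex
    using that by (simp add: algebra_simps)
  \<comment> \<open>Since \<open>Z e N 0\<close> is the difference of the two traces of zero modes,
    adding half of it to the second one gives their mean.\<close>
  moreover have "(if n = 1 then T (\<not> e) N 0 else 0) + (if n = 1 then - 1 / 2 * Z e N 0 else 0) + (if n = 1 then Z e N 0 else 0)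
     = (if n = 1 then (T e N 0 + T (\<not> e) N 0) / 2 else 0)"
    by (simp add: Z_0 field_simps)
  ultimately show ?thesis
    unfolding Z_neg_expand[OF n Q] B sum.distrib by (simp only:)
qed

text \<open>The traces \<open>T\<close> are replaced by their telescoped sums over \<open>a\<close>,
  the modes \<open>l\<close> and \<open>- l\<close> are combined by \<open>zcoef_power\<close>, and
  the terms are regrouped by p = l a, so that \<open>a\<close> becomes the cofactor
  \<open>p div l\<close>.\<close>

lemma sum_Lambert:
  assumes n: "n \<ge> 1" and Q: "int Q > N - N0"
  shows "(\<Sum>l\<in>{1..Q}. of_nat l ^ (n - 1) / fact (n - 1) * T e N (- int l) +
       (- of_nat l) ^ (n - 1) / fact (n - 1) * T (\<not> e) (N - int l) (int l)) =
    (\<Sum>m<M. if even (n + m) then zcoef n m * (\<Sum>p\<in>{1..Q}. \<Sum>l | l dvd p.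
        2 / fact (n + m - 1) * of_nat l ^ (n + m - 1) * Z (if even (p div l) then e else \<not> e) (N - int p) (int m)) else 0)"
proof -
  let ?e = "\<lambda>a::nat. if even a then e else \<not> e"
  let ?c = "\<lambda>m l. if even (n + m) then zcoef n m * (2 / fact (n + m - 1) * of_nat l ^ (n + m - 1)) else (0 :: complex)"
  have "(\<Sum>l\<in>{1..Q}. of_nat l ^ (n - 1) / fact (n - 1) * T e N (- int l) +
       (- of_nat l) ^ (n - 1) / fact (n - 1) * T (\<not> e) (N - int l) (int l)) =
     (\<Sum>l\<in>{1..Q}. \<Sum>a\<in>{1..Q}. \<Sum>m<M. ?c m l * Z (?e a) (N - int (l * a)) (int m))"
  proof (intro sum.cong refl)
    fix l assume l: "l \<in> {1..Q}"
    then have l1: "l \<ge> 1" by simp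
    have "of_nat l ^ (n - 1) / fact (n - 1) * T e N (- int l) + (- of_nat l) ^ (n - 1) / fact (n - 1) * T (\<not> e) (N - int l) (int l) =
      (\<Sum>a\<in>{1..Q}. (- of_nat l) ^ (n - 1) / fact (n - 1) * P (?e a) (N - int a * int l) (int l) -
        of_nat l ^ (n - 1) / fact (n - 1) * P (?e a) (N - int a * int l) (- int l))"
      unfolding T_neg[OF Q l1] T_pos[OF Q l1] by (simp add: sum_subtractf sum_distrib_left)
    also have "\<dots> = (\<Sum>a\<in>{1..Q}. \<Sum>m<M. ?c m l * Z (?e a) (N - int (l * a)) (int m))"
    proof (intro sum.cong refl)
      fix a
      have "(- of_nat l) ^ (n - 1) / fact (n - 1) * P (?e a) (N - int a * int l) (int l) -
        of_nat l ^ (n - 1) / fact (n - 1) * P (?e a) (N - int a * int l) (- int l) =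
        (\<Sum>m<M. ((- of_nat l) ^ (n - 1) / fact (n - 1) * (of_nat l ^ m / fact m)
          - of_nat l ^ (n - 1) / fact (n - 1) * ((- of_nat l) ^ m / fact m)) * Z (?e a) (N - int a * int l) (int m))"
        unfolding P_def sum_distrib_left sum_subtractf[symmetric]
        by (intro sum.cong refl) (simp add: left_diff_distrib mult.assoc)
      then show "(- of_nat l) ^ (n - 1) / fact (n - 1) * P (?e a) (N - int a * int l) (int l) -
        of_nat l ^ (n - 1) / fact (n - 1) * P (?e a) (N - int a * int l) (- int l) =
        (\<Sum>m<M. ?c m l * Z (?e a) (N - int (l * a)) (int m))"
        unfolding zcoef_power[OF n] by (simp add: mult.commute)
    qed
    finally show "of_nat l ^ (n - 1) / fact (n - 1) * T e N (- int l) + (- of_nat l) ^ (n - 1) / fact (n - 1) * T (\<not> e) (N - int l) (int l) =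
      (\<Sum>a\<in>{1..Q}. \<Sum>m<M. ?c m l * Z (?e a) (N - int (l * a)) (int m))" .
  qed
  also have "\<dots> = (\<Sum>l\<in>{1..Q}. \<Sum>m<M. \<Sum>a\<in>{1..Q}. ?c m l * Z (?e a) (N - int (l * a)) (int m))"
    by (rule sum.cong[OF refl sum.swap])
  also have "\<dots> = (\<Sum>m<M. \<Sum>l\<in>{1..Q}. \<Sum>a\<in>{1..Q}. ?c m l * Z (?e a) (N - int (l * a)) (int m))"
    by (rule sum.swap)
  also have "\<dots> = (\<Sum>m<M. \<Sum>p\<in>{1..Q}. \<Sum>l | l dvd p. ?c m l * Z (?e (p div l)) (N - int (l * (p div l))) (int m))"
  \<comment> \<open>A product above \<open>Q\<close> puts the weight \<open>N - int (l * a)\<close>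
    below \<open>N0\<close>, where \<open>Z\<close> vanishes.\<close>
  proof (rule sum.cong[OF refl], rule sum_divisor_pairs)
    fix m l a :: nat assume "l * a > Q"
    then have "int Q < int (l * a)" by (simp only: of_nat_less_iff)
    then show "?c m l * Z (?e a) (N - int (l * a)) (int m) = 0" using Q by (simp add: Z_vanish del: of_nat_mult)
  qed
  also have "\<dots> = (\<Sum>m<M. if even (n + m) then zcoef n m * (\<Sum>p\<in>{1..Q}. \<Sum>l | l dvd p.
        2 / fact (n + m - 1) * of_nat l ^ (n + m - 1) * Z (?e (p div l)) (N - int p) (int m)) else 0)"
    by (intro sum.cong refl) (simp add: sum_distrib_left mult.assoc)
  finally show ?thesis .
qed


text \<open>The two differences in \<open>Z_0\<close> are opposite. This accounts for the absence of
  \<open>m = 0\<close> from the sum with traces over all of V.\<close>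

lemma ZV_0: "Z True N 0 + Z False N 0 = 0"
  using Z_0[of True N] Z_0[of False N] by simp

text \<open>For odd cofactors the trace over V- is rewritten as that over V minus that over V+.
  Collecting the V+ part gives the coefficients of F_k, and the V part gives half of those of E_k -
  F_k.\<close>

lemma Z_neg_recursion:
  assumes n: "n \<ge> 1" and Q: "int Q > N - N0"
  shows "Z True N (- int n) =
    (if n = 1 then (T True N 0 + T False N 0) / 2 else 0) +
    (\<Sum>m<M. zcoef n m * (\<Sum>p\<le>Q. Fis (n + m) $ p * Z True (N - int p) (int m))) +
    (\<Sum>m<M. if m \<ge> 1 then zcoef n m / 2 *
       (\<Sum>p\<le>Q. (Eis (n + m) - Fis (n + m)) $ p * (Z True (N - int p) (int m) + Z False (N - int p) (int m))) else 0)"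
proof -
  let ?V = "\<lambda>p m. Z True (N - int p) (int m) + Z False (N - int p) (int m)"
  have split0: "(\<Sum>p\<le>Q. f p) = f 0 + (\<Sum>p\<in>{1..Q}. f p)" for f :: "nat \<Rightarrow> complex"
    by (subst sum.atMost_shift) (simp add: sum.atLeast1_atMost_eq)
  have m: "zcoef n m * Fis (n + m) $ 0 * Z True N (int m) +
     (if even (n + m) then zcoef n m * (\<Sum>p\<in>{1..Q}. \<Sum>l | l dvd p.
        2 / fact (n + m - 1) * of_nat l ^ (n + m - 1) * Z (if even (p div l) then True else \<not> True) (N - int p) (int m)) else 0) =
     zcoef n m * (\<Sum>p\<le>Q. Fis (n + m) $ p * Z True (N - int p) (int m)) +
     (if m \<ge> 1 then zcoef n m / 2 * (\<Sum>p\<le>Q. (Eis (n + m) - Fis (n + m)) $ p * ?V p m) else 0)" for m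
  proof (cases "even (n + m)")
    case False
    then show ?thesis by (simp add: Fis_odd Eis_odd)
  next
    case True
    have "(\<Sum>l | l dvd p. 2 / fact (n + m - 1) * of_nat l ^ (n + m - 1) * Z (if even (p div l) then True else \<not> True) (N - int p) (int m))
      = Fis (n + m) $ p * Z True (N - int p) (int m) + (Eis (n + m) - Fis (n + m)) $ p / 2 * ?V p m" if "p \<in> {1..Q}" for p
    proof -
      from that have p: "p \<ge> 1" by simp
      show ?thesis
        unfolding Fis_nth[OF True p] Eis_minus_Fis_nth[OF True p] sum_distrib_left sum_distrib_right sum_divide_distrib sum.distrib[symmetric]
        by (intro sum.cong refl) (auto simp: algebra_simps add_divide_distrib)
    qed
    then have "(\<Sum>p\<in>{1..Q}. \<Sum>l | l dvd p.
        2 / fact (n + m - 1) * of_nat l ^ (n + m - 1) * Z (if even (p div l) then True else \<not> True) (N - int p) (int m))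
      = (\<Sum>p\<in>{1..Q}. Fis (n + m) $ p * Z True (N - int p) (int m)) + (\<Sum>p\<in>{1..Q}. (Eis (n + m) - Fis (n + m)) $ p * ?V p m) / 2"
      by (simp add: sum.distrib sum_divide_distrib)
    moreover have "(\<Sum>p\<in>{1..Q}. (Eis (n + m) - Fis (n + m)) $ p * ?V p m) = 0" if "m = 0"
      using ZV_0 that by (simp del: fps_sub_nth)
    ultimately show ?thesis
      using True unfolding split0
      by (cases "m = 0") (simp_all add: Eis_minus_Fis_nth_0 distrib_left mult.assoc del: fps_sub_nth)
  qed
  have "(\<Sum>m<M. zcoef n m * Fis (n + m) $ 0 * Z True N (int m)) +
     (\<Sum>m<M. if even (n + m) then zcoef n m * (\<Sum>p\<in>{1..Q}. \<Sum>l | l dvd p.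
        2 / fact (n + m - 1) * of_nat l ^ (n + m - 1) * Z (if even (p div l) then True else \<not> True) (N - int p) (int m)) else 0) =
     (\<Sum>m<M. zcoef n m * (\<Sum>p\<le>Q. Fis (n + m) $ p * Z True (N - int p) (int m))) +
     (\<Sum>m<M. if m \<ge> 1 then zcoef n m / 2 * (\<Sum>p\<le>Q. (Eis (n + m) - Fis (n + m)) $ p * ?V p m) else 0)"
    unfolding sum.distrib[symmetric] m ..
  then show ?thesis
    unfolding Z_neg_constant_term[OF n Q] sum_Lambert[OF n Q] by (simp add: add.assoc)
qed

section \<open>Passage to Laurent series in q\<close>

lemma Zq_plus_nth: "Zq Y om {x. t x = x} (sqmode Y om u m v) $$ N = Z True N m"
proof -
  have "{x. t x = x} \<inter> V N = W True N" for N by (auto simp: W_def eigensp_def)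
  \<comment> \<open>Vanishing below \<open>N0\<close> is what makes the family of traces a Laurent
    series, so that \<open>Abs_fls\<close> returns it unchanged.\<close>
  then show ?thesis
    unfolding Zq_def using Z_vanish by (subst nth_Abs_fls_lower_bound[of N0]) (auto simp: Z_def)
qed

lemma Zq_UNIV_nth: "Zq Y om UNIV (sqmode Y om u m v) $$ N = Z True N m + Z False N m"
proof -
  have "ctrace (zmode Y om (sqmode Y om u m v)) (V N) = Z True N m + Z False N m" for N
    unfolding Z_def by (rule ctrace_V_split) (auto simp: zmode_eq_mode clin_mode zmode_sqmode_W[unfolded zmode_eq_mode])
  then show ?thesis
    unfolding Zq_def using Z_vanish by (subst nth_Abs_fls_lower_bound[of N0]) auto
qed

lemma Zq2_nth: "Zq2 Y om u v $$ N = T True N 0 + T False N 0"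
proof -
  have "ctrace (zmode Y om u \<circ> zmode Y om v) (V N) = T True N 0 + T False N 0" for N
    unfolding T_def zmode_eq_mode minus_zero
  proof (rule ctrace_V_split[OF clin_comp[OF clin_mode clin_mode]])
    show "(mode u 0 \<circ> mode v 0) x \<in> W e N" if "x \<in> W e N" for x e
      using mode_odd[OF u mode_odd[OF v that, of 0], of 0] by simp
  qed
  then show ?thesis
    unfolding Zq2_def using T_vanish by (subst nth_Abs_fls_lower_bound[of N0]) auto
qed

lemma sqmode_vanish: "m \<ge> M \<Longrightarrow> sqmode Y om u (int m) v = 0"
  using sqmode_eq[of M u v "int m"] modes_vanish_v by simp

text \<open>Terms with u[m]v = 0 contribute nothing, so the sums over the support become sums over
  \<open>m < M\<close>; comparing coefficients then reduces the claim to
  \<open>Z_neg_recursion\<close>.\<close>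

lemma Zq_recursion:
  assumes n: "n \<ge> 1"
  shows "Zq Y om {x. t x = x} (sqmode Y om u (- int n) v) =
      (if n = 1 then fls_const (1/2) * Zq2 Y om u v else 0)
      + (\<Sum>m | sqmode Y om u (int m) v \<noteq> 0.
           fls_const (zcoef n m) * fps_to_fls (Fis (n + m))
           * Zq Y om {x. t x = x} (sqmode Y om u (int m) v))
      + fls_const (1/2) * (\<Sum>m | m \<ge> 1 \<and> sqmode Y om u (int m) v \<noteq> 0.
           fls_const (zcoef n m) * fps_to_fls (Eis (n + m) - Fis (n + m))
           * Zq Y om UNIV (sqmode Y om u (int m) v))"
    (is "?L = ?A + (\<Sum>m | ?S m. ?F m) + fls_const (1/2) * (\<Sum>m | m \<ge> 1 \<and> ?S m. ?G m)")
proof -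
  have zero: "Z e N (int m) = 0" if "\<not> ?S m" for e N m
  proof -
    have "zmode Y om 0 = (\<lambda>x. 0)" using clin_0[OF clin_mode_left] by (auto simp: zmode_eq_mode)
    then show ?thesis using that by (simp add: Z_def findim_W)
  qed
  have zero': "Zq Y om {x. t x = x} (sqmode Y om u (int m) v) = 0" "Zq Y om UNIV (sqmode Y om u (int m) v) = 0"
    if "\<not> ?S m" for m
    using zero[OF that] by (auto intro!: fls_eqI simp: Zq_plus_nth Zq_UNIV_nth)
  have S: "m < M" if "?S m" for m using sqmode_vanish that by (meson not_less)
  have F: "(\<Sum>m | ?S m. ?F m) = (\<Sum>m<M. ?F m)"
    using S zero' by (intro sum.mono_neutral_left) auto
  have G: "(\<Sum>m | m \<ge> 1 \<and> ?S m. ?G m) = (\<Sum>m<M. if m \<ge> 1 then ?G m else 0)"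
    using S zero' by (intro sum.mono_neutral_cong_left) auto
  show ?thesis
    unfolding F G
  proof (rule fls_eqI)
    fix N
    \<comment> \<open>Any \<open>Q\<close> above \<open>N - N0\<close> will do: the terms of the
      convolution with index beyond \<open>Q\<close> involve weights below
      \<open>N0\<close>.\<close>
    define Q where "Q = nat (N - N0) + 1"
    have Q: "int Q > N - N0" by (simp add: Q_def)
    have Fn: "?F m $$ N = zcoef n m * (\<Sum>p\<le>Q. Fis (n + m) $ p * Z True (N - int p) (int m))" for m
      unfolding mult.assoc fls_mult_const_nth(1)
      by (subst fps_to_fls_times_nth[of N Q]) (use Q in \<open>auto simp: Zq_plus_nth Z_vanish\<close>)
    have Gn: "?G m $$ N = zcoef n m * (\<Sum>p\<le>Q. (Eis (n + m) - Fis (n + m)) $ p * (Z True (N - int p) (int m) + Z False (N - int p) (int m)))" for m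
      unfolding mult.assoc fls_mult_const_nth(1)
      by (subst fps_to_fls_times_nth[of N Q]) (use Q in \<open>auto simp: Zq_UNIV_nth Z_vanish\<close>)
    have "(?A + (\<Sum>m<M. ?F m) + fls_const (1/2) * (\<Sum>m<M. if m \<ge> 1 then ?G m else 0)) $$ N =
      (if n = 1 then (T True N 0 + T False N 0) / 2 else 0) + (\<Sum>m<M. ?F m $$ N) + (\<Sum>m<M. if m \<ge> 1 then ?G m $$ N / 2 else 0)"
      by (simp add: fls_nth_sum Zq2_nth sum_divide_distrib if_distrib[of "\<lambda>f. f $$ N"] if_distrib[of "\<lambda>x. x / 2"] cong: if_cong)
    also have "\<dots> = Z True N (- int n)"
      unfolding Fn Gn Z_neg_recursion[OF n Q] by (intro arg_cong2[where f = "(+)"] sum.cong refl) auto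
    finally show "?L $$ N = (?A + (\<Sum>m<M. ?F m) + fls_const (1/2) * (\<Sum>m<M. if m \<ge> 1 then ?G m else 0)) $$ N"
      by (simp add: Zq_plus_nth)
  qed
qed

end

theorem theorem6p1:
  fixes Y :: "'v::cvector \<Rightarrow> int \<Rightarrow> 'v \<Rightarrow> 'v" and vac om :: 'v and c :: complex
    and t :: "'v \<Rightarrow> 'v" and u v :: 'v and n :: nat
  assumes voa: "is_voa Y vac om c"
    and aut: "is_invol_aut Y vac om t"
    and u: "t u = - u" and v: "t v = - v"
    and n: "n \<ge> 1"
  shows "Zq Y om {x. t x = x} (sqmode Y om u (- int n) v) =
      (if n = 1 then fls_const (1/2) * Zq2 Y om u v else 0)
      + (\<Sum>m | sqmode Y om u (int m) v \<noteq> 0.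
           fls_const ((-1) ^ (m + 1) * of_nat ((n + m - 1) choose m)) * fps_to_fls (Fis (n + m))
           * Zq Y om {x. t x = x} (sqmode Y om u (int m) v))
      + fls_const (1/2) * (\<Sum>m | m \<ge> 1 \<and> sqmode Y om u (int m) v \<noteq> 0.
           fls_const ((-1) ^ (m + 1) * of_nat ((n + m - 1) choose m))
           * fps_to_fls (Eis (n + m) - Fis (n + m))
           * Zq Y om UNIV (sqmode Y om u (int m) v))"
proof -
  interpret voa Y vac om c using voa by unfold_locales
  obtain M where M: "\<And>w w' k. k \<ge> int M \<Longrightarrow> Y (wcomp Y om u w) k (wcomp Y om v w') = 0"
    using modes_bounded by blast
  obtain N0 where N0: "\<And>w. w < N0 \<Longrightarrow> wtsp Y om w = {0}" using V_lower by blast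
  \<comment> \<open>The successor secures positivity of the bound and still bounds the
    modes.\<close>
  interpret odd_pair Y vac om c t u v "Suc M" N0
    by unfold_locales (use aut u v M N0 in auto)
  show ?thesis using Zq_recursion[OF n] unfolding zcoef_def .
qed

end
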